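(* Let $G\in\mathcal{G}_{k,n,p}$ and $v\neq w\in V(G)$. Then \[ H_{wv}=\frac{2|E(G)|}{d(v)}-1+\frac{2|E(G)|}{d(v)}\cdot\frac{1}{|N(v)|}\sum_{u\in N(v)}\sum_{i=1}^{3k+1}\big(\mathbb{P}_u[X_i=v]-\mathbb{P}_w[X_i=v]\big)\pm\mathcal{O}\!\left(\frac{\sqrt{\log n}}{\sqrt{pn}}\right). \]
   Context: Fix an integer $k\ge2$ and let $p=p(n)$ satisfy $\frac{\log n}{n^{(k-1)/k}}\le p\le 1-\Omega(\frac{\log^4 n}{n})$. $\mathcal{G}_{k,n,p}$ denotes the set of graphs $G$ on $n$ vertices satisfying: (i) $G$ is not bipartite; (ii) $\operatorname{diam}(G)\le k$; (iii) every vertex has degree $d(v)=pn\pm\mathcal{O}(\sqrt{pn\log n})$; (iv) $2|E(G)|=pn^2\pm\mathcal{O}(\sqrt{pn^2\log n})$; (v) $|N(v)\cap N(w)|=p^2n\pm\mathcal{O}(\max\{\sqrt{p^2n\log n},\log n\})$ for all $v\ne w$; (vi) the unit eigenvector $\phi$ of the largest adjacency eigenvalue has entries $\phi_i=\frac1{\sqrt n}\pm\mathcal{O}(\frac{\log^{3/2}n}{\sqrt p\,n\log(pn)})$; (vii) $\lambda_1=(1+o(1))pn$; (viii) $\max\{|\lambda_2|,|\lambda_n|\}=\mathcal{O}(\sqrt{pn})$, where $\lambda_1\ge\dots\ge\lambda_n$ are the adjacency eigenvalues. Asymptotic notation is as $n\to\infty$ with constants independent of $n$. $X=X_0,X_1,\dots$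 is a simple random walk on $G$, $\mathbb{P}_u[\cdot]=\mathbb{P}[\cdot\mid X_0=u]$, $H_{wv}$ is the expected first hitting time of $v$ from $w$, and $N(v)$, $d(v)$ are the neighbourhood and degree of $v$. *)

theory Defs
  imports Complex_Main "Jordan_Normal_Form.Char_Poly"
begin

definition is_graph :: "nat \<Rightarrow> (nat \<Rightarrow> nat \<Rightarrow> bool) \<Rightarrow> bool" where
  "is_graph n E \<longleftrightarrow> (\<forall>x<n. \<forall>y<n. E x y \<longleftrightarrow> E y x) \<and> (\<forall>x<n. \<not> E x x)"

definition nbhd :: "nat \<Rightarrow> (nat \<Rightarrow> nat \<Rightarrow> bool) \<Rightarrow> nat \<Rightarrow> nat set" where
  "nbhd n E v = {u. u < n \<and> E v u}"

definition deg :: "nat \<Rightarrow> (nat \<Rightarrow> nat \<Rightarrow> bool) \<Rightarrow> nat \<Rightarrow> nat" where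
  "deg n E v = card (nbhd n E v)"

definition num_edges :: "nat \<Rightarrow> (nat \<Rightarrow> nat \<Rightarrow> bool) \<Rightarrow> nat" where
  "num_edges n E = card {(x, y). x < y \<and> y < n \<and> E x y}"

definition bipartite :: "nat \<Rightarrow> (nat \<Rightarrow> nat \<Rightarrow> bool) \<Rightarrow> bool" where
  "bipartite n E \<longleftrightarrow> (\<exists>S. \<forall>x<n. \<forall>y<n. E x y \<longrightarrow> (x \<in> S \<longleftrightarrow> y \<notin> S))"

definition is_walk :: "nat \<Rightarrow> (nat \<Rightarrow> nat \<Rightarrow> bool) \<Rightarrow> nat list \<Rightarrow> bool" where
  "is_walk n E xs \<longleftrightarrow> xs \<noteq> [] \<and> set xs \<subseteq> {..<n} \<and>
     (\<forall>i. Suc i < length xs \<longrightarrow> E (xs ! i) (xs ! Suc i))"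

definition diam_le :: "nat \<Rightarrow> (nat \<Rightarrow> nat \<Rightarrow> bool) \<Rightarrow> nat \<Rightarrow> bool" where
  "diam_le n E k \<longleftrightarrow> (\<forall>u<n. \<forall>v<n. \<exists>xs. is_walk n E xs \<and> hd xs = u \<and> last xs = v \<and> length xs \<le> k + 1)"

fun rw_prob :: "nat \<Rightarrow> (nat \<Rightarrow> nat \<Rightarrow> bool) \<Rightarrow> nat \<Rightarrow> nat \<Rightarrow> nat \<Rightarrow> real" where
  "rw_prob n E 0 u v = (if u = v then 1 else 0)"
| "rw_prob n E (Suc i) u v = (\<Sum>x\<in>nbhd n E u. rw_prob n E i x v) / real (deg n E u)"

text \<open>rw_avoid n E t u v = P_u[X_0 \<noteq> v, ..., X_t \<noteq> v] = P_u[T_v > t], T_v the first hitting time of v.\<close>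
fun rw_avoid :: "nat \<Rightarrow> (nat \<Rightarrow> nat \<Rightarrow> bool) \<Rightarrow> nat \<Rightarrow> nat \<Rightarrow> nat \<Rightarrow> real" where
  "rw_avoid n E 0 u v = (if u = v then 0 else 1)"
| "rw_avoid n E (Suc t) u v =
     (if u = v then 0 else (\<Sum>x\<in>nbhd n E u. rw_avoid n E t x v) / real (deg n E u))"

text \<open>Expected hitting time H_{wv} = E_w[T_v] = sum_{t \<ge> 0} P_w[T_v > t].\<close>
definition hitting_time :: "nat \<Rightarrow> (nat \<Rightarrow> nat \<Rightarrow> bool) \<Rightarrow> nat \<Rightarrow> nat \<Rightarrow> real" where
  "hitting_time n E w v = (\<Sum>t. rw_avoid n E t w v)"

definition adj_mat :: "nat \<Rightarrow> (nat \<Rightarrow> nat \<Rightarrow> bool) \<Rightarrow> real mat" where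
  "adj_mat n E = mat n n (\<lambda>(i, j). if E i j then 1 else 0)"

definition adj_eigs :: "nat \<Rightarrow> (nat \<Rightarrow> nat \<Rightarrow> bool) \<Rightarrow> real list" where
  "adj_eigs n E = (THE ls. length ls = n \<and> sorted_wrt (\<ge>) ls \<and>
      char_poly (adj_mat n E) = (\<Prod>l\<leftarrow>ls. [:- l, 1:]))"

text \<open>Membership in G_{k,n,p}, with the implicit constants of all O(.)-terms bounded by C,
  and the o(1) term in (vii) bounded in absolute value by eps.\<close>
definition in_class :: "nat \<Rightarrow> real \<Rightarrow> real \<Rightarrow> nat \<Rightarrow> real \<Rightarrow> (nat \<Rightarrow> nat \<Rightarrow> bool) \<Rightarrow> bool" where
  "in_class k C eps n p E \<longleftrightarrow>
     is_graph n E \<and>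
     \<not> bipartite n E \<and>
     diam_le n E k \<and>
     (\<forall>v<n. \<bar>real (deg n E v) - p * n\<bar> \<le> C * sqrt (p * n * ln n)) \<and>
     \<bar>2 * real (num_edges n E) - p * n^2\<bar> \<le> C * sqrt (p * n^2 * ln n) \<and>
     (\<forall>v<n. \<forall>w<n. v \<noteq> w \<longrightarrow>
        \<bar>real (card (nbhd n E v \<inter> nbhd n E w)) - p^2 * n\<bar>
          \<le> C * max (sqrt (p^2 * n * ln n)) (ln n)) \<and>
     (let ls = adj_eigs n E; A = adj_mat n E in
       (\<exists>\<phi> \<in> carrier_vec n. A *\<^sub>v \<phi> = ls ! 0 \<cdot>\<^sub>v \<phi> \<and> (\<Sum>i<n. (\<phi> $ i)^2) = 1 \<and>
          (\<forall>i<n. \<bar>\<phi> $ i - 1 / sqrt n\<bar> \<le> C * ln n powr (3/2) / (sqrt p * n * ln (p * n)))) \<and>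
       \<bar>ls ! 0 - p * n\<bar> \<le> eps * (p * n) \<and>
       max \<bar>ls ! 1\<bar> \<bar>ls ! (n - 1)\<bar> \<le> C * sqrt (p * n))"

end

theory Submission
  imports Defs "Jordan_Normal_Form.Schur_Decomposition"
begin

text \<open>
  Write \<open>f\<^sub>i(u)\<close> for the probability of being at \<open>v\<close> after \<open>i\<close> steps from \<open>u\<close>. The potential
  \<open>D(u) = \<Sum>\<^sub>i (f\<^sub>i(v) - f\<^sub>i(u))\<close> satisfies \<open>D(u) = L + \<close> (mean of \<open>D\<close> over \<open>N(u)\<close>) off \<open>v\<close>, where
  \<open>L = d(v) / 2|E|\<close> is the stationary mass of \<open>v\<close>, so \<open>D / L\<close> solves the first-step equations and
  equals the hitting time. Evaluating the same recursion at \<open>v\<close> gives the stated formula with the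
  inner sum extended over all \<open>i\<close>, and it remains to bound the tail \<open>i \<ge> 3k + 2\<close>. By the
  eigenvalue bound and the near-regularity of the degrees, one step shrinks the distance of \<open>f\<^sub>i\<close>
  from the constants by a factor of order \<open>1 / \<surd>(pn)\<close>. As \<open>(pn)^k \<ge> n\<close>, the tail is of order
  \<open>1 / (n \<surd>(pn))\<close>, and it is multiplied by \<open>2|E| / d(v)\<close>, which is of order \<open>n\<close>.
\<close>

section \<open>Inner products and linear spans of real functions on the vertices\<close>

text \<open>Vectors are plain functions on the naturals of which only the values below
  \<open>n\<close> count. Equality of vectors therefore means agreement below \<open>n\<close>,
  which is what the congruence rules express.\<close>

definition ip :: "nat \<Rightarrow> (nat \<Rightarrow> real) \<Rightarrow> (nat \<Rightarrow> real) \<Rightarrow> real" where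
  "ip n f g = (\<Sum>x<n. f x * g x)"

lemma ip_commute: "ip n f g = ip n g f"
  by (simp add: ip_def mult.commute)

lemma ip_cong: "(\<And>x. x < n \<Longrightarrow> f x = f' x) \<Longrightarrow> (\<And>x. x < n \<Longrightarrow> g x = g' x) \<Longrightarrow> ip n f g = ip n f' g'"
  by (simp add: ip_def)

lemma ip_add: "ip n (\<lambda>x. f x + g x) h = ip n f h + ip n g h"
  and ip_diff: "ip n (\<lambda>x. f x - g x) h = ip n f h - ip n g h"
  and ip_scale: "ip n (\<lambda>x. c * f x) h = c * ip n f h"
  by (simp_all add: ip_def algebra_simps sum.distrib sum_subtractf sum_distrib_left)

lemma ip_scale_right: "ip n h (\<lambda>x. c * f x) = c * ip n h f"
  by (simp add: ip_def algebra_simps sum_distrib_left)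

lemma ip_sum: "ip n (\<lambda>x. \<Sum>i\<in>I. c i * w i x) h = (\<Sum>i\<in>I. c i * ip n (w i) h)"
proof -
  have "ip n (\<lambda>x. \<Sum>i\<in>I. c i * w i x) h = (\<Sum>x<n. \<Sum>i\<in>I. c i * w i x * h x)"
    by (simp add: ip_def sum_distrib_right)
  also have "\<dots> = (\<Sum>i\<in>I. \<Sum>x<n. c i * w i x * h x)"
    by (rule sum.swap)
  finally show ?thesis by (simp add: ip_def sum_distrib_left mult.assoc)
qed

lemma ip_nonneg: "0 \<le> ip n f f"
  by (simp add: ip_def sum_nonneg)

lemma ip_self_eq_0_iff: "ip n f f = 0 \<longleftrightarrow> (\<forall>x<n. f x = 0)"
  by (auto simp: ip_def sum_nonneg_eq_0_iff)

lemma ip_Cauchy_Schwarz: "(ip n f g)\<^sup>2 \<le> ip n f f * ip n g g"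
proof (cases "ip n g g = 0")
  case True
  then have "ip n f g = 0" unfolding ip_self_eq_0_iff by (simp add: ip_def)
  then show ?thesis using True by simp
next
  case False
  then have pos: "ip n g g > 0" using ip_nonneg[of n g] by simp
  define c where "c = ip n f g / ip n g g"
  have "0 \<le> ip n (\<lambda>x. f x - c * g x) (\<lambda>x. f x - c * g x)" by (rule ip_nonneg)
  also have "\<dots> = ip n f f - 2 * c * ip n f g + c\<^sup>2 * ip n g g"
    by (simp add: ip_diff ip_scale ip_commute[of n _ "\<lambda>x. f x - c * g x"] ip_commute[of n g f]
        algebra_simps power2_eq_square)
  also have "\<dots> = ip n f f - (ip n f g)\<^sup>2 / ip n g g"
    using pos by (simp add: c_def field_simps power2_eq_square)
  finally show ?thesis using pos by (simp add: field_simps)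
qed

definition lspan :: "nat \<Rightarrow> nat \<Rightarrow> (nat \<Rightarrow> nat \<Rightarrow> real) \<Rightarrow> (nat \<Rightarrow> real) set" where
  "lspan n k w = {f. \<exists>c. \<forall>x<n. f x = (\<Sum>i<k. c i * w i x)}"

lemma lspan_cong: "f \<in> lspan n k w \<Longrightarrow> (\<And>x. x < n \<Longrightarrow> g x = f x) \<Longrightarrow> g \<in> lspan n k w"
  unfolding lspan_def by auto

lemma lspan_cong_basis: "(\<And>i x. i < k \<Longrightarrow> w i x = w' i x) \<Longrightarrow> lspan n k w = lspan n k w'"
  unfolding lspan_def by simp

lemma lspan_scale: "f \<in> lspan n k w \<Longrightarrow> (\<lambda>x. a * f x) \<in> lspan n k w"
  unfolding lspan_def
proof clarify
  fix c assume "\<forall>x<n. f x = (\<Sum>i<k. c i * w i x)"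
  then show "\<exists>c. \<forall>x<n. a * f x = (\<Sum>i<k. c i * w i x)"
    by (intro exI[of _ "\<lambda>i. a * c i"]) (simp add: sum_distrib_left mult.assoc)
qed

lemma lspan_add:
  assumes "f \<in> lspan n k w" "g \<in> lspan n k w"
  shows "(\<lambda>x. f x + g x) \<in> lspan n k w"
proof -
  obtain c d where "\<forall>x<n. f x = (\<Sum>i<k. c i * w i x)" "\<forall>x<n. g x = (\<Sum>i<k. d i * w i x)"
    using assms unfolding lspan_def by auto
  then show ?thesis unfolding lspan_def
    by (auto intro!: exI[of _ "\<lambda>i. c i + d i"] simp: distrib_right sum.distrib)
qed

lemma lspan_diff:
  assumes "f \<in> lspan n k w" "g \<in> lspan n k w"
  shows "(\<lambda>x. f x - g x) \<in> lspan n k w"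
  using lspan_add[OF assms(1) lspan_scale[OF assms(2), of "-1"]] by simp

lemma lspan_zero: "(\<lambda>x. 0) \<in> lspan n k w"
  unfolding lspan_def by (auto intro!: exI[of _ "\<lambda>_. 0"])

lemma lspan_sum:
  assumes "finite I" "\<And>i. i \<in> I \<Longrightarrow> u i \<in> lspan n k w"
  shows "(\<lambda>x. \<Sum>i\<in>I. a i * u i x) \<in> lspan n k w"
  using assms by (induction I) (auto intro!: lspan_zero lspan_add lspan_scale)

lemma lspan_base: "i < k \<Longrightarrow> w i \<in> lspan n k w"
  unfolding lspan_def
  by (auto intro!: exI[of _ "\<lambda>j. if j = i then 1 else 0"] simp: if_distrib[of "\<lambda>z. z * _"] cong: if_cong)

lemma lspan_trans:
  assumes "f \<in> lspan n k u" "\<And>i. i < k \<Longrightarrow> u i \<in> lspan n m w"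
  shows "f \<in> lspan n m w"
proof -
  obtain c where "\<forall>x<n. f x = (\<Sum>i<k. c i * u i x)"
    using assms(1) unfolding lspan_def by auto
  moreover have "(\<lambda>x. \<Sum>i<k. c i * u i x) \<in> lspan n m w"
    by (rule lspan_sum) (use assms(2) in auto)
  ultimately show ?thesis by (auto elim: lspan_cong)
qed

lemma lspan_mono: "f \<in> lspan n k w \<Longrightarrow> k \<le> m \<Longrightarrow> f \<in> lspan n m w"
  by (erule lspan_trans) (auto intro: lspan_base)

lemma lspan_orthogonal_imp_0:
  assumes "f \<in> lspan n k w" "\<And>i. i < k \<Longrightarrow> ip n f (w i) = 0" "x < n"
  shows "f x = 0"
proof -
  obtain c where c: "\<forall>x<n. f x = (\<Sum>i<k. c i * w i x)"
    using assms(1) unfolding lspan_def by auto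
  have "ip n f f = ip n (\<lambda>x. \<Sum>i<k. c i * w i x) f"
    by (rule ip_cong) (use c in auto)
  also have "\<dots> = 0"
    unfolding ip_sum using assms(2) by (simp add: ip_commute)
  finally show ?thesis using assms(3) by (simp add: ip_self_eq_0_iff)
qed

section \<open>Symmetric matrices as operators, and passage from triangular to diagonal form\<close>

definition mat_app :: "nat \<Rightarrow> (nat \<Rightarrow> nat \<Rightarrow> real) \<Rightarrow> (nat \<Rightarrow> real) \<Rightarrow> nat \<Rightarrow> real" where
  "mat_app n a f x = (\<Sum>y<n. a x y * f y)"

lemma mat_app_cong: "(\<And>y. y < n \<Longrightarrow> f y = g y) \<Longrightarrow> mat_app n a f x = mat_app n a g x"
  by (simp add: mat_app_def)

lemma mat_app_diff: "mat_app n a (\<lambda>x. f x - g x) x = mat_app n a f x - mat_app n a g x"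
  and mat_app_scale: "mat_app n a (\<lambda>x. c * f x) x = c * mat_app n a f x"
  by (simp_all add: mat_app_def algebra_simps sum.distrib sum_subtractf sum_distrib_left)

lemma mat_app_sum: "mat_app n a (\<lambda>x. \<Sum>i\<in>I. c i * w i x) x = (\<Sum>i\<in>I. c i * mat_app n a (w i) x)"
proof -
  have "mat_app n a (\<lambda>x. \<Sum>i\<in>I. c i * w i x) x = ip n (\<lambda>x. \<Sum>i\<in>I. c i * w i x) (a x)"
    by (simp add: mat_app_def ip_def mult.commute)
  then show ?thesis unfolding ip_sum by (simp add: mat_app_def ip_def mult.commute)
qed

lemma mat_app_symmetric:
  assumes "\<And>x y. x < n \<Longrightarrow> y < n \<Longrightarrow> a x y = a y x"
  shows "ip n (mat_app n a f) g = ip n f (mat_app n a g)"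
proof -
  have "ip n (mat_app n a f) g = (\<Sum>x<n. \<Sum>y<n. a x y * f y * g x)"
    by (simp add: ip_def mat_app_def sum_distrib_right)
  also have "\<dots> = (\<Sum>y<n. \<Sum>x<n. a x y * f y * g x)" by (rule sum.swap)
  also have "\<dots> = (\<Sum>y<n. \<Sum>x<n. f y * (a y x * g x))"
    by (intro sum.cong refl) (auto simp: assms)
  finally show ?thesis by (simp add: ip_def mat_app_def sum_distrib_left)
qed

text \<open>Gram-Schmidt applied to a basis that triangularises a symmetric matrix already diagonalises it.\<close>
lemma gram_schmidt_eigenbasis:
  fixes a t p :: "nat \<Rightarrow> nat \<Rightarrow> real"
  assumes sym: "\<And>x y. x < n \<Longrightarrow> y < n \<Longrightarrow> a x y = a y x"
    and tri: "\<And>j x. j < n \<Longrightarrow> x < n \<Longrightarrow> mat_app n a (p j) x = t j j * p j x + (\<Sum>i<j. t i j * p i x)"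
    and dual: "\<And>i j. i < n \<Longrightarrow> j < n \<Longrightarrow> ip n (q i) (p j) = (if i = j then 1 else 0)"
    and "k \<le> n"
  shows "\<exists>w. (\<forall>i<k. \<forall>j<k. ip n (w i) (w j) = (if i = j then 1 else 0)) \<and>
    (\<forall>i<k. \<forall>x<n. mat_app n a (w i) x = t i i * w i x) \<and>
    (\<forall>i<k. w i \<in> lspan n k p) \<and> (\<forall>i<k. p i \<in> lspan n k w)"
  using \<open>k \<le> n\<close>
proof (induction k)
  case 0
  show ?case by auto
next
  case (Suc k)
  then have k: "k < n" by simp
  obtain w where w: "(\<forall>i<k. \<forall>j<k. ip n (w i) (w j) = (if i = j then 1 else 0)) \<and>
    (\<forall>i<k. \<forall>x<n. mat_app n a (w i) x = t i i * w i x) \<and>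
    (\<forall>i<k. w i \<in> lspan n k p) \<and> (\<forall>i<k. p i \<in> lspan n k w)"
    using Suc.IH[OF less_imp_le[OF k]] by (rule exE)
  have orth: "ip n (w i) (w j) = (if i = j then 1 else 0)" if "i < k" "j < k" for i j
    using w that by blast
  have eig: "mat_app n a (w i) x = t i i * w i x" if "i < k" "x < n" for i x
    using w that by blast
  have wp: "w i \<in> lspan n k p" and pw: "p i \<in> lspan n k w" if "i < k" for i
    using w that by blast+
  define b where "b i = ip n (p k) (w i)" for i
  \<comment> \<open>The residual of \<open>p k\<close> after projection onto the span of the vectors
    built so far; normalised, it becomes the next basis vector.\<close>
  define r where "r x = p k x - (\<Sum>i<k. b i * w i x)" for x
  have r_orth: "ip n r (w i) = 0" if "i < k" for i
  proof -
    have "ip n r (w i) = b i - (\<Sum>j<k. b j * ip n (w j) (w i))"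
      unfolding r_def ip_diff ip_sum by (simp add: b_def)
    also have "(\<Sum>j<k. b j * ip n (w j) (w i)) = (\<Sum>j<k. if j = i then b j else 0)"
      by (rule sum.cong) (use that in \<open>auto simp: orth\<close>)
    finally show ?thesis using that by simp
  qed
  \<comment> \<open>The dual family \<open>q\<close> encodes linear independence: pairing with
    \<open>q k\<close> kills every earlier \<open>p i\<close> but gives 1 on
    \<open>p k\<close>.\<close>
  have pk: "p k \<notin> lspan n k w"
  proof
    assume "p k \<in> lspan n k w"
    then have "p k \<in> lspan n k p" using wp by (rule lspan_trans)
    then obtain c where c: "\<forall>x<n. p k x = (\<Sum>i<k. c i * p i x)" unfolding lspan_def by auto
    have "ip n (p k) (q k) = ip n (\<lambda>x. \<Sum>i<k. c i * p i x) (q k)"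
      by (rule ip_cong) (use c in auto)
    also have "\<dots> = 0" unfolding ip_sum
      by (rule sum.neutral) (use k dual in \<open>auto simp: ip_commute[of n _ "q k"]\<close>)
    finally show False using dual[OF k k] by (simp add: ip_commute)
  qed
  have sum_span: "(\<lambda>x. \<Sum>i<k. d i * w i x) \<in> lspan n k w" for d
    by (rule lspan_sum) (auto intro: lspan_base)
  have r_ne: "ip n r r \<noteq> 0"
  proof
    assume "ip n r r = 0"
    then have "\<forall>x<n. p k x = (\<Sum>i<k. b i * w i x)"
      unfolding ip_self_eq_0_iff by (simp add: r_def)
    then have "p k \<in> lspan n k w" unfolding lspan_def by blast
    with pk show False ..
  qed
  \<comment> \<open>The defect \<open>?s\<close> lies in the span of the earlier \<open>w i\<close>
    because the matrix is triangular on the \<open>p i\<close>. It is also orthogonal to each of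
    them: symmetry moves the matrix onto \<open>w i\<close>, which is an eigenvector, and
    \<open>r\<close> is orthogonal to \<open>w i\<close>. Hence it vanishes.\<close>
  have r_eig: "mat_app n a r x = t k k * r x" if "x < n" for x
  proof -
    let ?s = "\<lambda>x. mat_app n a r x - t k k * r x"
    have s: "?s x = (\<Sum>i<k. t i k * p i x) - (\<Sum>i<k. (b i * t i i) * w i x) + t k k * (\<Sum>i<k. b i * w i x)"
      if "x < n" for x
    proof -
      have "(\<Sum>i<k. b i * mat_app n a (w i) x) = (\<Sum>i<k. (b i * t i i) * w i x)"
        by (rule sum.cong) (use that in \<open>auto simp: eig\<close>)
      then show ?thesis
        using tri[OF k that] unfolding r_def mat_app_diff mat_app_sum by (simp add: algebra_simps)
    qed
    have "(\<lambda>x. (\<Sum>i<k. t i k * p i x) - (\<Sum>i<k. (b i * t i i) * w i x) + t k k * (\<Sum>i<k. b i * w i x))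
        \<in> lspan n k w"
      by (intro lspan_add lspan_diff lspan_scale sum_span lspan_sum) (auto intro: pw)
    then have "?s \<in> lspan n k w" by (rule lspan_cong) (rule s)
    moreover have "ip n ?s (w i) = 0" if "i < k" for i
    proof -
      have "ip n (mat_app n a r) (w i) = ip n r (mat_app n a (w i))"
        by (rule mat_app_symmetric) (rule sym)
      also have "\<dots> = ip n r (\<lambda>x. t i i * w i x)"
        by (rule ip_cong) (use eig that in auto)
      finally show ?thesis using r_orth[OF that] by (simp add: ip_diff ip_scale ip_scale_right)
    qed
    ultimately have "?s x = 0" using that by (rule lspan_orthogonal_imp_0)
    then show ?thesis by simp
  qed
  define e where "e = 1 / sqrt (ip n r r)"
  have e: "e * e * ip n r r = 1"
    using r_ne ip_nonneg[of n r] by (simp add: e_def)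
  have e0: "e \<noteq> 0" using e by auto
  define w' where "w' = w(k := \<lambda>x. e * r x)"
  have w'_less: "w' i = w i" if "i < k" for i using that by (simp add: w'_def)
  have w'_k: "w' k = (\<lambda>x. e * r x)" by (simp add: w'_def)
  have span_w': "lspan n k w' = lspan n k w" by (rule lspan_cong_basis) (simp add: w'_less)
  have up: "f \<in> lspan n (Suc k) w'" if "f \<in> lspan n k w" for f
    using lspan_mono[of f n k w' "Suc k"] that by (simp add: span_w')
  have pk': "p k \<in> lspan n (Suc k) w'"
  proof -
    have "(\<lambda>x. 1 / e * w' k x + (\<Sum>i<k. b i * w i x)) \<in> lspan n (Suc k) w'"
      by (intro lspan_add lspan_scale up sum_span lspan_base) simp
    then show ?thesis by (rule lspan_cong) (use e0 in \<open>simp add: w'_k r_def\<close>)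
  qed
  have wk': "w' k \<in> lspan n (Suc k) p" unfolding w'_k r_def
    by (intro lspan_scale lspan_diff lspan_sum lspan_base) (auto intro: lspan_mono[OF wp])
  show ?case
  proof (intro exI[of _ w'] conjI allI impI)
    fix i j assume "i < Suc k" "j < Suc k"
    then show "ip n (w' i) (w' j) = (if i = j then 1 else 0)"
      using orth r_orth e
      by (auto simp: less_Suc_eq w'_less w'_k ip_scale ip_scale_right ip_commute[of n "w _" r])
  next
    fix i x assume "i < Suc k" "x < n"
    then show "mat_app n a (w' i) x = t i i * w' i x"
      by (auto simp: less_Suc_eq w'_less w'_k mat_app_scale eig r_eig)
  next
    fix i assume "i < Suc k"
    then show "w' i \<in> lspan n (Suc k) p"
      using wk' lspan_mono[OF wp, of i "Suc k"] by (auto simp: less_Suc_eq w'_less)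
  next
    fix i assume "i < Suc k"
    then show "p i \<in> lspan n (Suc k) w'"
      using pk' by (auto simp: less_Suc_eq intro: up pw)
  qed
qed

section \<open>Real spectrum, orthonormal eigenbasis and norm bound\<close>

text \<open>The polynomial determines the multiset of its roots, and a multiset has only one
  decreasing arrangement. The lists are reversed in the proof because \<open>sort\<close> is
  ascending.\<close>

lemma linear_factors_eq_imp_sorted_eq:
  fixes ls ms :: "real list"
  assumes "(\<Prod>l\<leftarrow>ls. [:- l, 1:]) = (\<Prod>l\<leftarrow>ms. [:- l, 1:])"
    and "sorted_wrt (\<ge>) ls" "sorted_wrt (\<ge>) ms"
  shows "ls = ms"
proof -
  have roots: "proots (\<Prod>l\<leftarrow>xs. [:- l, 1:]) = mset xs" for xs :: "real list"
  proof (induction xs)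
    case (Cons l xs)
    have "(\<Prod>l\<leftarrow>xs. [:- l, 1:]) \<noteq> 0" by (auto simp: prod_list_zero_iff)
    then have "proots ([:- l, 1:] * (\<Prod>l\<leftarrow>xs. [:- l, 1:])) = {#l#} + proots (\<Prod>l\<leftarrow>xs. [:- l, 1:])"
      by (subst proots_mult) auto
    with Cons show ?case by simp
  qed simp
  have "mset ls = mset ms" using assms(1) roots by metis
  then have "sort (rev ms) = rev ls"
    using assms(2) by (intro properties_for_sort) (auto simp: sorted_wrt_rev)
  moreover have "sort (rev ms) = rev ms"
    using assms(3) by (intro properties_for_sort) (auto simp: sorted_wrt_rev)
  ultimately show ?thesis by simp
qed

lemma prod_list_mset_cong:
  "mset xs = mset ys \<Longrightarrow> prod_list xs = (prod_list ys :: 'a :: comm_monoid_mult)"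
  by (metis prod_mset_prod_list)

text \<open>Split an eigenvector into real part \<open>f\<close> and imaginary part
  \<open>g\<close>. Pair the real part of the eigenvalue equation with \<open>g\<close> and the
  imaginary part with \<open>f\<close>; self-adjointness equates the two, leaving
  \<open>Im z\<close> times the squared norm of the eigenvector equal to 0.\<close>

lemma symmetric_complex_eigenvalue_real:
  fixes a :: "nat \<Rightarrow> nat \<Rightarrow> real"
  assumes sym: "\<And>x y. x < n \<Longrightarrow> y < n \<Longrightarrow> a x y = a y x"
    and ev: "eigenvalue (mat n n (\<lambda>(i, j). complex_of_real (a i j))) z"
  shows "Im z = 0"
proof -
  obtain v where v: "v \<in> carrier_vec n" "v \<noteq> 0\<^sub>v n"
    and eq: "mat n n (\<lambda>(i, j). complex_of_real (a i j)) *\<^sub>v v = z \<cdot>\<^sub>v v"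
    using ev unfolding eigenvalue_def eigenvector_def by auto
  define f g where "f x = Re (v $ x)" and "g x = Im (v $ x)" for x
  have eqx: "(\<Sum>y<n. complex_of_real (a x y) * v $ y) = z * v $ x" if "x < n" for x
  proof -
    have "(mat n n (\<lambda>(i, j). complex_of_real (a i j)) *\<^sub>v v) $ x = (z \<cdot>\<^sub>v v) $ x"
      by (simp add: eq)
    then show ?thesis using that v(1) by (simp add: scalar_prod_def lessThan_atLeast0)
  qed
  have "mat_app n a f x = Re z * f x - Im z * g x" if "x < n" for x
    using arg_cong[OF eqx[OF that], of Re] by (simp add: mat_app_def f_def g_def)
  then have "ip n (mat_app n a f) g = Re z * ip n f g - Im z * ip n g g"
    by (subst ip_cong[of n "mat_app n a f" "\<lambda>x. Re z * f x - Im z * g x" g g])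
      (auto simp: ip_diff ip_scale)
  moreover have "mat_app n a g x = Re z * g x + Im z * f x" if "x < n" for x
    using arg_cong[OF eqx[OF that], of Im] by (simp add: mat_app_def f_def g_def)
  then have "ip n (mat_app n a g) f = Re z * ip n g f + Im z * ip n f f"
    by (subst ip_cong[of n "mat_app n a g" "\<lambda>x. Re z * g x + Im z * f x" f f])
      (auto simp: ip_add ip_scale)
  moreover have "ip n (mat_app n a f) g = ip n (mat_app n a g) f"
    using mat_app_symmetric[of n a f g] sym by (simp add: ip_commute)
  ultimately have "Im z * (ip n f f + ip n g g) = 0"
    by (simp add: ip_commute[of n g f] algebra_simps)
  moreover have "ip n f f + ip n g g \<noteq> 0"
  proof
    assume "ip n f f + ip n g g = 0"
    then have "ip n f f = 0" "ip n g g = 0" using ip_nonneg[of n f] ip_nonneg[of n g] by auto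
    then have "v $ x = 0" if "x < n" for x
      unfolding ip_self_eq_0_iff using that by (auto simp: f_def g_def complex_eq_iff)
    with v show False by auto
  qed
  ultimately show ?thesis by simp
qed

interpretation of_real_poly_hom: map_poly_inj_idom_hom "of_real :: real \<Rightarrow> complex" ..

text \<open>The polynomial factors over the complex numbers, its roots are eigenvalues of a
  symmetric real matrix and hence real, and injectivity of the embedding of coefficients carries the
  factorisation back to the reals. Sorting then only permutes the factors.\<close>

lemma symmetric_char_poly_splits:
  fixes a :: "nat \<Rightarrow> nat \<Rightarrow> real"
  assumes sym: "\<And>x y. x < n \<Longrightarrow> y < n \<Longrightarrow> a x y = a y x"
  shows "\<exists>ls. length ls = n \<and> sorted_wrt (\<ge>) ls \<and>
    char_poly (mat n n (\<lambda>(i, j). a i j)) = (\<Prod>l\<leftarrow>ls. [:- l, 1:])"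
proof -
  let ?A = "mat n n (\<lambda>(i, j). a i j)"
  let ?C = "mat n n (\<lambda>(i, j). complex_of_real (a i j))"
  have C: "?C = map_mat of_real ?A" by auto
  obtain zs where zs: "char_poly ?C = (\<Prod>z\<leftarrow>zs. [:- z, 1:])" "length zs = n"
    using char_poly_factorized[of ?C n] by auto
  have "Im z = 0" if "z \<in> set zs" for z
  proof (rule symmetric_complex_eigenvalue_real)
    show "eigenvalue ?C z" using that
      by (subst eigenvalue_root_char_poly[of _ n])
        (auto simp: zs Missing_Polynomial.poly_prod_list prod_list_zero_iff)
  qed (use sym in auto)
  then have re: "map (\<lambda>z. complex_of_real (Re z)) zs = zs"
    by (intro map_idI) (auto simp: complex_eq_iff)
  have "map_poly complex_of_real (\<Prod>l\<leftarrow>xs. [:- l, 1:]) = (\<Prod>l\<leftarrow>xs. [:- of_real l, 1:])" for xs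
    by (simp add: of_real_poly_hom.hom_prod_list o_def)
  then have "map_poly complex_of_real (\<Prod>l\<leftarrow>map Re zs. [:- l, 1:]) = (\<Prod>l\<leftarrow>map Re zs. [:- of_real l, 1:])" .
  also have "\<dots> = (\<Prod>l\<leftarrow>map (\<lambda>z. complex_of_real (Re z)) zs. [:- l, 1:])"
    by (simp add: o_def)
  also have "\<dots> = map_poly of_real (char_poly ?A)"
    unfolding re zs(1)[symmetric] C by (rule of_real_hom.char_poly_hom[of _ n]) simp
  finally have p: "(\<Prod>l\<leftarrow>map Re zs. [:- l, 1:]) = char_poly ?A"
    by simp
  have "char_poly ?A = (\<Prod>l\<leftarrow>rev (sort (map Re zs)). [:- l, 1:])"
    unfolding p[symmetric] by (intro prod_list_mset_cong) (simp add: multiset.map_comp)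
  moreover have "sorted_wrt (\<ge>) (rev (sort (map Re zs)))" by (simp add: sorted_wrt_rev)
  ultimately show ?thesis using zs(2) by (intro exI[of _ "rev (sort (map Re zs))"]) simp
qed

text \<open>The eigenvalue list is defined by a definite description, so its properties become
  available only through unique existence: the splitting gives existence, the decreasing order gives
  uniqueness.\<close>

lemma adj_eigs:
  assumes "is_graph n E"
  shows "length (adj_eigs n E) = n" "sorted_wrt (\<ge>) (adj_eigs n E)"
    "char_poly (adj_mat n E) = (\<Prod>l\<leftarrow>adj_eigs n E. [:- l, 1:])"
proof -
  have sym: "(if E i j then 1 else 0 :: real) = (if E j i then 1 else 0)" if "i < n" "j < n" for i j
    using assms that unfolding is_graph_def by metis
  have "\<exists>!ls. length ls = n \<and> sorted_wrt (\<ge>) ls \<and> char_poly (adj_mat n E) = (\<Prod>l\<leftarrow>ls. [:- l, 1:])"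
  proof (rule ex_ex1I)
    show "\<exists>ls. length ls = n \<and> sorted_wrt (\<ge>) ls \<and> char_poly (adj_mat n E) = (\<Prod>l\<leftarrow>ls. [:- l, 1:])"
      unfolding adj_mat_def by (rule symmetric_char_poly_splits) (rule sym)
  next
    fix ls ms :: "real list"
    assume "length ls = n \<and> sorted_wrt (\<ge>) ls \<and> char_poly (adj_mat n E) = (\<Prod>l\<leftarrow>ls. [:- l, 1:])"
      and "length ms = n \<and> sorted_wrt (\<ge>) ms \<and> char_poly (adj_mat n E) = (\<Prod>l\<leftarrow>ms. [:- l, 1:])"
    then show "ls = ms" by (intro linear_factors_eq_imp_sorted_eq) simp_all
  qed
  from theI'[OF this]
  show "length (adj_eigs n E) = n" "sorted_wrt (\<ge>) (adj_eigs n E)"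
    "char_poly (adj_mat n E) = (\<Prod>l\<leftarrow>adj_eigs n E. [:- l, 1:])"
    unfolding adj_eigs_def by blast+
qed

text \<open>In a Schur decomposition \<open>P * T * Q\<close> with diagonal \<open>ls\<close>, the
  columns of \<open>P\<close> triangularise the matrix and the rows of \<open>Q\<close> are dual to
  them. Gram-Schmidt then yields eigenvectors, and the prescribed diagonal attaches
  \<open>w i\<close> to \<open>ls ! i\<close>.\<close>

lemma symmetric_eigenbasis:
  fixes a :: "nat \<Rightarrow> nat \<Rightarrow> real"
  assumes sym: "\<And>x y. x < n \<Longrightarrow> y < n \<Longrightarrow> a x y = a y x"
    and cp: "char_poly (mat n n (\<lambda>(i, j). a i j)) = (\<Prod>l\<leftarrow>ls. [:- l, 1:])"
  obtains w where "\<And>i j. i < n \<Longrightarrow> j < n \<Longrightarrow> ip n (w i) (w j) = (if i = j then 1 else 0)"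
    "\<And>i x. i < n \<Longrightarrow> x < n \<Longrightarrow> mat_app n a (w i) x = ls ! i * w i x"
    "\<And>f. f \<in> lspan n n w"
proof -
  let ?A = "mat n n (\<lambda>(i, j). a i j)"
  obtain T P Q where "schur_decomposition ?A ls = (T, P, Q)" by (metis prod_cases3)
  from schur_decomposition[OF _ cp this, of n]
  have wit: "similar_mat_wit ?A T P Q" and ut: "upper_triangular T" and diag: "diag_mat T = ls"
    by auto
  have car: "T \<in> carrier_mat n n" "P \<in> carrier_mat n n" "Q \<in> carrier_mat n n"
    and PQ: "P * Q = 1\<^sub>m n" and QP: "Q * P = 1\<^sub>m n" and A: "?A = P * T * Q"
    using wit unfolding similar_mat_wit_def Let_def by auto
  have dims: "dim_row T = n" "dim_col T = n" "dim_row P = n" "dim_col P = n" "dim_row Q = n" "dim_col Q = n"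
    using car by auto
  have AP: "?A * P = P * T"
  proof -
    have "?A * P = P * T * (Q * P)" unfolding A using car by (simp add: assoc_mult_mat[of _ n n _ n _ n])
    then show ?thesis using car by (simp add: QP)
  qed
  define t p q where "t i j = T $$ (i, j)" and "p j x = P $$ (x, j)" and "q i x = Q $$ (i, x)" for i j x
  have tri: "mat_app n a (p j) x = t j j * p j x + (\<Sum>i<j. t i j * p i x)" if "j < n" "x < n" for j x
  proof -
    have "mat_app n a (p j) x = (?A * P) $$ (x, j)"
      using that dims by (simp add: mat_app_def p_def scalar_prod_def lessThan_atLeast0)
    also have "\<dots> = (\<Sum>i<n. t i j * p i x)"
      unfolding AP using that dims by (simp add: t_def p_def scalar_prod_def lessThan_atLeast0 mult.commute)
    also have "\<dots> = (\<Sum>i\<in>{..<Suc j}. t i j * p i x)"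
      by (rule sum.mono_neutral_right)
        (use that ut dims in \<open>auto simp: t_def upper_triangular_def not_less_eq\<close>)
    finally show ?thesis by simp
  qed
  have dual: "ip n (q i) (p j) = (if i = j then 1 else 0)" if "i < n" "j < n" for i j
  proof -
    have "ip n (q i) (p j) = (Q * P) $$ (i, j)"
      using that dims by (simp add: ip_def q_def p_def scalar_prod_def lessThan_atLeast0)
    then show ?thesis using that by (simp add: QP)
  qed
  \<comment> \<open>Since \<open>P * Q\<close> is the identity, pairing \<open>f\<close> with the
    rows of \<open>Q\<close> gives its coordinates in the columns of \<open>P\<close>.\<close>
  have span_p: "f \<in> lspan n n p" for f
  proof -
    have "f x = (\<Sum>i<n. ip n f (\<lambda>y. q i y) * p i x)" if "x < n" for x
    proof -
      have "(\<Sum>i<n. ip n f (\<lambda>y. q i y) * p i x) = (\<Sum>i<n. \<Sum>y<n. f y * (p i x * q i y))"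
        by (simp add: ip_def sum_distrib_left sum_distrib_right mult_ac)
      also have "\<dots> = (\<Sum>y<n. f y * (\<Sum>i<n. p i x * q i y))"
        by (subst sum.swap) (simp add: sum_distrib_left)
      also have "\<dots> = (\<Sum>y<n. f y * (P * Q) $$ (x, y))"
        by (intro sum.cong refl)
          (use that dims in \<open>auto simp: q_def p_def scalar_prod_def lessThan_atLeast0\<close>)
      also have "\<dots> = (\<Sum>y<n. if y = x then f y else 0)"
        by (intro sum.cong refl) (use that in \<open>auto simp: PQ\<close>)
      finally show ?thesis using that by simp
    qed
    then show ?thesis unfolding lspan_def
      by (intro CollectI exI[of _ "\<lambda>i. ip n f (\<lambda>y. q i y)"]) simp
  qed
  obtain w where orth: "\<forall>i<n. \<forall>j<n. ip n (w i) (w j) = (if i = j then 1 else 0)"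
    and eig: "\<forall>i<n. \<forall>x<n. mat_app n a (w i) x = t i i * w i x"
    and pw: "\<forall>i<n. p i \<in> lspan n n w"
    using gram_schmidt_eigenbasis[of n a p t q n, OF sym tri dual] by blast
  have "t i i = ls ! i" if "i < n" for i
    using that dims by (simp add: diag[symmetric] diag_mat_def t_def)
  moreover have "f \<in> lspan n n w" for f
    using span_p pw by (blast intro: lspan_trans)
  ultimately show ?thesis using that orth eig by metis
qed

text \<open>The gap between \<open>m\<close> and the top eigenvalue forces \<open>h\<close> to be
  parallel to \<open>w 0\<close>, so a vector orthogonal to \<open>h\<close> has no component there.
  Each remaining coordinate is multiplied by at most \<open>m\<close> in absolute value, and
  Parseval sums this up.\<close>

lemma symmetric_norm_bound:
  fixes a :: "nat \<Rightarrow> nat \<Rightarrow> real"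
  assumes sym: "\<And>x y. x < n \<Longrightarrow> y < n \<Longrightarrow> a x y = a y x"
    and cp: "char_poly (mat n n (\<lambda>(i, j). a i j)) = (\<Prod>l\<leftarrow>ls. [:- l, 1:])"
    and le: "\<And>i. 0 < i \<Longrightarrow> i < n \<Longrightarrow> \<bar>ls ! i\<bar> \<le> m" and top: "m < \<bar>ls ! 0\<bar>"
    and eig: "\<And>x. x < n \<Longrightarrow> mat_app n a h x = ls ! 0 * h x" and "ip n h h \<noteq> 0"
    and "ip n g h = 0"
  shows "ip n (mat_app n a g) (mat_app n a g) \<le> m\<^sup>2 * ip n g g"
proof -
  obtain w where orth: "\<And>i j. i < n \<Longrightarrow> j < n \<Longrightarrow> ip n (w i) (w j) = (if i = j then 1 else 0)"
    and w_eig: "\<And>i x. i < n \<Longrightarrow> x < n \<Longrightarrow> mat_app n a (w i) x = ls ! i * w i x"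
    and span: "\<And>f. f \<in> lspan n n w"
    using symmetric_eigenbasis[OF sym cp] by blast
  \<comment> \<open>Eigenvectors for different eigenvalues are orthogonal; \<open>ls ! 0\<close> and
    \<open>ls ! i\<close> differ because their absolute values are separated by
    \<open>m\<close>.\<close>
  have h_orth: "ip n h (w i) = 0" if "0 < i" "i < n" for i
  proof -
    have "ls ! 0 * ip n h (w i) = ip n (mat_app n a h) (w i)"
      unfolding ip_scale[symmetric] by (rule ip_cong) (auto simp: eig)
    also have "\<dots> = ip n h (mat_app n a (w i))" by (rule mat_app_symmetric) (rule sym)
    also have "\<dots> = ls ! i * ip n h (w i)"
      unfolding ip_scale_right[symmetric] by (rule ip_cong) (use that in \<open>auto simp: w_eig\<close>)
    finally show ?thesis using le[OF that] top by auto
  qed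
  obtain c where c: "\<forall>x<n. g x = (\<Sum>i<n. c i * w i x)" using span[of g] unfolding lspan_def by auto
  have coeff: "ip n (\<lambda>x. \<Sum>i<n. d i * w i x) (w j) = d j" if "j < n" for d j
  proof -
    have "(\<Sum>i<n. d i * ip n (w i) (w j)) = (\<Sum>i<n. if i = j then d i else 0)"
      by (intro sum.cong refl) (use that in \<open>auto simp: orth\<close>)
    then show ?thesis using that by (simp add: ip_sum)
  qed
  have parseval: "ip n (\<lambda>x. \<Sum>i<n. d i * w i x) (\<lambda>x. \<Sum>i<n. d i * w i x) = (\<Sum>i<n. (d i)\<^sup>2)" for d
    unfolding ip_sum[of n d w "{..<n}" "\<lambda>x. \<Sum>i<n. d i * w i x"]
    by (intro sum.cong refl) (simp add: ip_commute[of n "w _"] coeff power2_eq_square)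
  have c0: "c 0 = 0" if "0 < n"
  proof -
    obtain b where b: "\<forall>x<n. h x = (\<Sum>i<n. b i * w i x)" using span[of h] unfolding lspan_def by auto
    have hw: "ip n h (w j) = b j" if "j < n" for j
      unfolding coeff[OF that, of b, symmetric] by (rule ip_cong) (use b in auto)
    have "ip n h h = (\<Sum>i<n. (b i)\<^sup>2)"
      unfolding parseval[symmetric] by (rule ip_cong) (use b in auto)
    also have "\<dots> = (\<Sum>i<n. if i = 0 then (b i)\<^sup>2 else 0)"
      by (intro sum.cong refl) (use h_orth hw in \<open>auto\<close>)
    finally have b0: "b 0 \<noteq> 0" using \<open>ip n h h \<noteq> 0\<close> that by auto
    have "0 = ip n g h" using assms by simp
    also have "\<dots> = ip n (\<lambda>x. \<Sum>i<n. c i * w i x) h" by (rule ip_cong) (use c in auto)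
    also have "\<dots> = (\<Sum>i<n. if i = 0 then c i * b i else 0)"
      unfolding ip_sum by (intro sum.cong refl) (use h_orth hw in \<open>auto simp: ip_commute[of n "w _"]\<close>)
    finally show ?thesis using b0 that by simp
  qed
  have "mat_app n a g x = (\<Sum>i<n. (c i * ls ! i) * w i x)" if "x < n" for x
  proof -
    have "mat_app n a g x = mat_app n a (\<lambda>x. \<Sum>i<n. c i * w i x) x"
      by (rule mat_app_cong) (use c in auto)
    then show ?thesis unfolding mat_app_sum using that by (simp add: w_eig mult_ac)
  qed
  then have "ip n (mat_app n a g) (mat_app n a g) = (\<Sum>i<n. (c i * ls ! i)\<^sup>2)"
    unfolding parseval[symmetric] by (intro ip_cong)
  also have "\<dots> \<le> (\<Sum>i<n. m\<^sup>2 * (c i)\<^sup>2)"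
  proof (intro sum_mono)
    fix i assume "i \<in> {..<n}"
    then have "c i \<noteq> 0 \<Longrightarrow> \<bar>ls ! i\<bar> \<le> m" using c0 le[of i] by (cases "i = 0") auto
    then have "c i \<noteq> 0 \<Longrightarrow> (ls ! i)\<^sup>2 \<le> m\<^sup>2" using abs_le_square_iff[of "ls ! i" m] by auto
    then show "(c i * ls ! i)\<^sup>2 \<le> m\<^sup>2 * (c i)\<^sup>2"
      by (cases "c i = 0") (auto simp: power_mult_distrib mult.commute mult_left_mono)
  qed
  also have "\<dots> = m\<^sup>2 * ip n g g"
  proof -
    have "ip n g g = (\<Sum>i<n. (c i)\<^sup>2)"
      unfolding parseval[symmetric] by (rule ip_cong) (use c in auto)
    then show ?thesis by (simp add: sum_distrib_left)
  qed
  finally show ?thesis .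
qed

section \<open>Adjacency operator and degrees\<close>

definition adj :: "(nat \<Rightarrow> nat \<Rightarrow> bool) \<Rightarrow> nat \<Rightarrow> nat \<Rightarrow> real" where
  "adj E x y = (if E x y then 1 else 0)"

lemma adj_symmetric: "is_graph n E \<Longrightarrow> x < n \<Longrightarrow> y < n \<Longrightarrow> adj E x y = adj E y x"
  by (auto simp: is_graph_def adj_def)

lemma finite_nbhd [simp]: "finite (nbhd n E u)"
  by (rule finite_subset[of _ "{..<n}"]) (auto simp: nbhd_def)

lemma nbhd_less: "x \<in> nbhd n E u \<Longrightarrow> x < n"
  by (simp add: nbhd_def)

text \<open>The bridge between neighbourhood averages of the walk and the spectral
  estimates.\<close>

lemma sum_nbhd: "(\<Sum>x\<in>nbhd n E u. g x) = mat_app n (adj E) g u"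
proof -
  have "(\<Sum>x\<in>nbhd n E u. g x) = (\<Sum>x | x \<in> {..<n} \<and> E u x. g x)"
    by (rule sum.cong) (auto simp: nbhd_def)
  also have "\<dots> = (\<Sum>x<n. if E u x then g x else 0)"
    by (rule sum.inter_filter) simp
  finally show ?thesis
    by (auto simp: mat_app_def adj_def intro!: sum.cong)
qed

lemma mat_app_adj_one: "mat_app n (adj E) (\<lambda>x. 1) u = real (deg n E u)"
  by (simp flip: sum_nbhd add: deg_def)

text \<open>Ordered adjacent pairs split by orientation into two mirror images of the edge
  set.\<close>

lemma handshake:
  assumes "is_graph n E"
  shows "(\<Sum>u<n. deg n E u) = 2 * num_edges n E"
proof -
  let ?U = "{(x, y). x < y \<and> y < n \<and> E x y}" and ?L = "{(x, y). y < x \<and> x < n \<and> E x y}"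
  have fin: "finite ?U" "finite ?L"
    by (rule finite_subset[of _ "{..<n} \<times> {..<n}"]; auto)+
  have "(\<Sum>u<n. deg n E u) = card (SIGMA u:{..<n}. nbhd n E u)"
    by (simp add: deg_def)
  also have "(SIGMA u:{..<n}. nbhd n E u) = ?U \<union> ?L"
    using assms by (auto simp: nbhd_def is_graph_def) (metis linorder_neqE_nat)
  also have "card (?U \<union> ?L) = card ?U + card ?L"
    by (rule card_Un_disjoint) (use fin in auto)
  also have "card ?L = card ?U"
    by (rule bij_betw_same_card[of prod.swap])
      (use assms in \<open>auto simp: bij_betw_def inj_on_def is_graph_def image_iff\<close>)
  finally show ?thesis by (simp add: num_edges_def)
qed

section \<open>First-step equations and the series for hitting times\<close>

lemma rw_avoid_nonneg: "0 \<le> rw_avoid n E t u v"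
  by (induction t arbitrary: u) (auto intro!: divide_nonneg_nonneg sum_nonneg)

lemma nbhd_mean_mono:
  "(\<And>x. x < n \<Longrightarrow> f x \<le> g x) \<Longrightarrow>
    (\<Sum>x\<in>nbhd n E u. f x) / real (deg n E u) \<le> (\<Sum>x\<in>nbhd n E u. g x) / real (deg n E u)"
  by (intro divide_right_mono sum_mono) (auto dest: nbhd_less)

lemma nbhd_mean_const:
  "deg n E u > 0 \<Longrightarrow> (\<Sum>x\<in>nbhd n E u. c) / real (deg n E u) = c"
  by (auto simp: deg_def)

text \<open>With \<open>T\<close> the hitting time of \<open>v\<close>, the sum of the survival
  probabilities over \<open>s < t\<close> is the expectation of \<open>min T t\<close>. This is
  first-step analysis for that truncated expectation.\<close>

lemma rw_avoid_partial_sum: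
  assumes "u \<noteq> v"
  shows "(\<Sum>s<Suc t. rw_avoid n E s u v) =
    1 + (\<Sum>x\<in>nbhd n E u. \<Sum>s<t. rw_avoid n E s x v) / real (deg n E u)"
proof -
  have "(\<Sum>s<t. rw_avoid n E (Suc s) u v) =
      (\<Sum>s<t. \<Sum>x\<in>nbhd n E u. rw_avoid n E s x v) / real (deg n E u)"
    using assms by (simp add: sum_divide_distrib)
  also have "\<dots> = (\<Sum>x\<in>nbhd n E u. \<Sum>s<t. rw_avoid n E s x v) / real (deg n E u)"
    by (subst sum.swap) simp
  finally show ?thesis unfolding sum.lessThan_Suc_shift using assms by simp
qed

lemma rw_avoid_target: "rw_avoid n E t v v = 0"
  by (cases t) auto

text \<open>A bounded solution of the first-step equations is, up to a constant, a supersolution, which makes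
  the survival probabilities summable; the error of the partial sums is then controlled by the
  survival probability itself. No connectivity is needed.\<close>
lemma hitting_time_unique:
  assumes pos: "\<And>u. u < n \<Longrightarrow> deg n E u > 0"
    and hv: "h v = 0"
    and step: "\<And>u. u < n \<Longrightarrow> u \<noteq> v \<Longrightarrow> h u = 1 + (\<Sum>x\<in>nbhd n E u. h x) / real (deg n E u)"
    and "w < n"
  shows "hitting_time n E w v = h w"
proof -
  define M where "M = (\<Sum>u<n. \<bar>h u\<bar>)"
  have M: "\<bar>h u\<bar> \<le> M" if "u < n" for u
    unfolding M_def by (rule member_le_sum) (use that in auto)
  define S where "S t u = (\<Sum>s<t. rw_avoid n E s u v)" for t u
  have S_Suc: "S (Suc t) u = 1 + (\<Sum>x\<in>nbhd n E u. S t x) / real (deg n E u)" if "u \<noteq> v" for t u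
    unfolding S_def by (rule rw_avoid_partial_sum[OF that])
  have S_v: "S t v = 0" for t by (simp add: S_def rw_avoid_target)
  \<comment> \<open>On vertices \<open>h + M\<close> is nonnegative, so it dominates the empty sum,
    and averaging over neighbours preserves the domination.\<close>
  have bound: "S t u \<le> h u + M" if "u < n" for t u
    using that
  proof (induction t arbitrary: u)
    case 0
    then show ?case using M[of u] by (auto simp: S_def)
  next
    case (Suc t)
    show ?case
    proof (cases "u = v")
      case True
      then show ?thesis using M[of u] Suc.prems hv by (simp add: S_v)
    next
      case False
      have "(\<Sum>x\<in>nbhd n E u. S t x) / real (deg n E u) \<le> (\<Sum>x\<in>nbhd n E u. h x + M) / real (deg n E u)"
        by (rule nbhd_mean_mono) (rule Suc.IH)
      also have "\<dots> = (\<Sum>x\<in>nbhd n E u. h x) / real (deg n E u) + M"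
        using nbhd_mean_const[OF pos[OF Suc.prems], of M] by (simp add: sum.distrib add_divide_distrib)
      finally show ?thesis using step[OF Suc.prems False] S_Suc[OF False] by simp
    qed
  qed
  have "summable (\<lambda>t. rw_avoid n E t w v)"
    by (rule summableI_nonneg_bounded[of _ "h w + M"])
      (use bound[OF \<open>w < n\<close>] in \<open>auto simp: S_def rw_avoid_nonneg\<close>)
  then have lim0: "(\<lambda>t. rw_avoid n E t w v) \<longlonglongrightarrow> 0" by (rule summable_LIMSEQ_zero)
  \<comment> \<open>At time 0 the error is at most \<open>M\<close> off \<open>v\<close> and is 0 at
    \<open>v\<close>. Afterwards the error and the survival probability obey the same averaging
    recursion, as the constant 1 cancels in the difference.\<close>
  have err: "\<bar>S t u - h u\<bar> \<le> M * rw_avoid n E t u v" if "u < n" for t u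
    using that
  proof (induction t arbitrary: u)
    case 0
    then show ?case using M[of u] hv by (auto simp: S_def)
  next
    case (Suc t)
    show ?case
    proof (cases "u = v")
      case True
      then show ?thesis using hv by (simp add: S_v)
    next
      case False
      have "S (Suc t) u - h u = (\<Sum>x\<in>nbhd n E u. S t x - h x) / real (deg n E u)"
        using step[OF Suc.prems False] S_Suc[OF False] by (simp add: sum_subtractf diff_divide_distrib)
      then have "\<bar>S (Suc t) u - h u\<bar> = \<bar>\<Sum>x\<in>nbhd n E u. S t x - h x\<bar> / real (deg n E u)"
        by (simp add: abs_divide)
      also have "\<dots> \<le> (\<Sum>x\<in>nbhd n E u. \<bar>S t x - h x\<bar>) / real (deg n E u)"
        by (intro divide_right_mono sum_abs) auto
      also have "\<dots> \<le> (\<Sum>x\<in>nbhd n E u. M * rw_avoid n E t x v) / real (deg n E u)"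
        by (rule nbhd_mean_mono) (rule Suc.IH)
      finally show ?thesis using False by (simp add: sum_distrib_left)
    qed
  qed
  have "(\<lambda>t. S t w - h w) \<longlonglongrightarrow> 0"
  proof (rule tendsto_0_le[OF lim0, where K = M])
    show "\<forall>\<^sub>F t in sequentially. norm (S t w - h w) \<le> norm (rw_avoid n E t w v) * M"
      using err[OF \<open>w < n\<close>] by (simp add: rw_avoid_nonneg mult.commute)
  qed
  then have "(\<lambda>t. rw_avoid n E t w v) sums h w"
    by (simp add: sums_def S_def LIM_zero_iff)
  then show ?thesis by (simp add: hitting_time_def sums_iff)
qed

text \<open>Reversibility: the weight \<open>deg n E u\<close> cancels the denominator of a walk
  step, and symmetry of the adjacency operator moves it onto the constant 1, which it turns back
  into degrees.\<close>

lemma rw_prob_invariant: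
  assumes "is_graph n E" "v < n" "\<And>u. u < n \<Longrightarrow> deg n E u > 0"
  shows "(\<Sum>u<n. real (deg n E u) * rw_prob n E i u v) = real (deg n E v)"
proof (induction i)
  case 0
  have "(\<Sum>u<n. real (deg n E u) * rw_prob n E 0 u v) = (\<Sum>u<n. if u = v then real (deg n E u) else 0)"
    by (intro sum.cong) auto
  then show ?case using assms(2) by simp
next
  case (Suc i)
  let ?f = "\<lambda>u. rw_prob n E i u v"
  have "(\<Sum>u<n. real (deg n E u) * rw_prob n E (Suc i) u v) = (\<Sum>u<n. mat_app n (adj E) ?f u * 1)"
    using assms(3) by (intro sum.cong) (auto simp: sum_nbhd)
  also have "\<dots> = ip n (mat_app n (adj E) ?f) (\<lambda>u. 1)" by (simp add: ip_def)
  also have "\<dots> = ip n ?f (mat_app n (adj E) (\<lambda>u. 1))"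
    by (rule mat_app_symmetric) (rule adj_symmetric[OF assms(1)])
  also have "\<dots> = (\<Sum>u<n. real (deg n E u) * ?f u)"
    by (simp add: ip_def mat_app_adj_one mult.commute)
  finally show ?case using Suc.IH by simp
qed

text \<open>Decay is required of differences between starting points, since the probabilities
  themselves tend to the stationary mass of \<open>v\<close>, which is positive.\<close>

lemma hitting_time_series:
  assumes graph: "is_graph n E" and pos: "\<And>u. u < n \<Longrightarrow> deg n E u > 0"
    and v: "v < n" and w: "w < n" "w \<noteq> v"
    and \<rho>: "0 \<le> \<rho>" "\<rho> < 1"
    and decay: "\<And>i u x. u < n \<Longrightarrow> x < n \<Longrightarrow> \<bar>rw_prob n E i u v - rw_prob n E i x v\<bar> \<le> K * \<rho> ^ i"
  shows "hitting_time n E w v = 2 * real (num_edges n E) / real (deg n E v) - 1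
    + 2 * real (num_edges n E) / real (deg n E v) * (1 / real (deg n E v))
      * (\<Sum>u\<in>nbhd n E v. \<Sum>i. rw_prob n E i u v - rw_prob n E i w v)"
proof -
  define f where "f i u = rw_prob n E i u v" for i u
  have summ: "summable (\<lambda>i. f i u - f i x)" if "u < n" "x < n" for u x
    by (rule summable_comparison_test'[where g = "\<lambda>i. K * \<rho> ^ i" and N = 0])
      (use \<rho> decay that in \<open>auto simp: f_def intro!: summable_mult summable_geometric\<close>)
  define m where "m = 2 * real (num_edges n E)"
  have m: "m = (\<Sum>u<n. real (deg n E u))"
    using arg_cong[OF handshake[OF graph], of real] by (simp add: m_def)
  have dv: "real (deg n E v) > 0" using pos[OF v] by simp
  have "real (deg n E v) \<le> m" unfolding m by (rule member_le_sum) (use v in auto)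
  with dv have m0: "m > 0" by linarith
  define L where "L = real (deg n E v) / m"
  have L0: "L > 0" using dv m0 by (simp add: L_def)
  \<comment> \<open>The degree-weighted average of \<open>f i\<close> is exactly \<open>L\<close>
    for every \<open>i\<close>, so \<open>f i u - L\<close> is a weighted average of differences
    \<open>f i u - f i x\<close>.\<close>
  have lim: "(\<lambda>i. f i u) \<longlonglongrightarrow> L" if "u < n" for u
  proof -
    have close: "\<bar>f i u - L\<bar> \<le> K * \<rho> ^ i" for i
    proof -
      have "m * (f i u - L) = (\<Sum>x<n. real (deg n E x) * (f i u - f i x))"
        using rw_prob_invariant[OF graph v pos, of i] m0
        by (simp add: L_def right_diff_distrib sum_subtractf f_def m[symmetric] flip: sum_distrib_right)
      also have "\<bar>\<dots>\<bar> \<le> (\<Sum>x<n. \<bar>real (deg n E x) * (f i u - f i x)\<bar>)" by (rule sum_abs)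
      also have "\<dots> \<le> (\<Sum>x<n. real (deg n E x) * (K * \<rho> ^ i))"
        unfolding abs_mult using decay[OF that]
        by (intro sum_mono mult_mono) (auto simp: f_def)
      also have "\<dots> = m * (K * \<rho> ^ i)" by (simp add: m sum_distrib_right)
      finally show ?thesis using m0 by (simp add: abs_mult)
    qed
    have "(\<lambda>i. f i u - L) \<longlonglongrightarrow> 0"
    proof (rule tendsto_0_le[OF LIMSEQ_realpow_zero[OF \<rho>], where K = K])
      show "\<forall>\<^sub>F i in sequentially. norm (f i u - L) \<le> norm (\<rho> ^ i) * K"
        using close \<rho>(1) by (simp add: mult.commute)
    qed
    then show ?thesis by (simp add: LIM_zero_iff)
  qed
  define D where "D u = (\<Sum>i. f i v - f i u)" for u
  have D: "(\<lambda>i. f i v - f i u) sums D u" if "u < n" for u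
    unfolding D_def by (rule summable_sums) (rule summ[OF v that])
  have Dv: "D v = 0" by (simp add: D_def)
  \<comment> \<open>Averaging over neighbours shifts the time index by one; the resulting
    discrepancy telescopes to \<open>L - f 0 u\<close>. As \<open>f 0 u\<close> is 1 at
    \<open>v\<close> and 0 elsewhere, one identity covers both the first-step equations and the
    value at \<open>v\<close>.\<close>
  have D_step: "D u = (\<Sum>x\<in>nbhd n E u. D x) / real (deg n E u) + L - f 0 u" if "u < n" for u
  proof -
    have "(\<lambda>i. (\<Sum>x\<in>nbhd n E u. f i v - f i x) / real (deg n E u)) sums
        ((\<Sum>x\<in>nbhd n E u. D x) / real (deg n E u))"
      by (intro sums_divide sums_sum D) (auto dest: nbhd_less)
    also have "(\<lambda>i. (\<Sum>x\<in>nbhd n E u. f i v - f i x) / real (deg n E u)) = (\<lambda>i. f i v - f (Suc i) u)"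
      using pos[OF that] by (simp add: sum_subtractf diff_divide_distrib nbhd_mean_const f_def del: sum_constant)
    finally have "(\<lambda>i. (f i v - f (Suc i) u) + (f (Suc i) u - f i u)) sums
        ((\<Sum>x\<in>nbhd n E u. D x) / real (deg n E u) + (L - f 0 u))"
      by (intro sums_add telescope_sums lim that)
    then have "(\<lambda>i. f i v - f i u) sums ((\<Sum>x\<in>nbhd n E u. D x) / real (deg n E u) + (L - f 0 u))"
      by simp
    from sums_unique2[OF D[OF that] this] show ?thesis by simp
  qed
  have H: "hitting_time n E w v = D w / L"
  proof (rule hitting_time_unique[where h = "\<lambda>u. D u / L"])
    fix u assume u: "u < n" "u \<noteq> v"
    then have "D u / L = ((\<Sum>x\<in>nbhd n E u. D x) / real (deg n E u) + L) / L"
      using D_step[OF u(1)] by (simp add: f_def)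
    also have "\<dots> = 1 + (\<Sum>x\<in>nbhd n E u. D x / L) / real (deg n E u)"
      using L0 by (simp add: add_divide_distrib sum_divide_distrib[symmetric])
    finally show "D u / L = 1 + (\<Sum>x\<in>nbhd n E u. D x / L) / real (deg n E u)" .
  qed (use pos Dv w in auto)
  have "(\<Sum>i. f i u - f i w) = D w - D u" if "u < n" for u
    using sums_diff[OF D[OF w(1)] D[OF that]] by (simp add: sums_iff)
  then have "(\<Sum>u\<in>nbhd n E v. \<Sum>i. f i u - f i w) = (\<Sum>u\<in>nbhd n E v. D w - D u)"
    by (intro sum.cong) (auto dest: nbhd_less)
  then have "(1 / real (deg n E v)) * (\<Sum>u\<in>nbhd n E v. \<Sum>i. f i u - f i w) =
      D w - (\<Sum>u\<in>nbhd n E v. D u) / real (deg n E v)"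
    using nbhd_mean_const[OF pos[OF v], of "D w"]
    by (simp add: sum_subtractf diff_divide_distrib del: sum_constant)
  \<comment> \<open>The recursion at \<open>v\<close>, where \<open>D v = 0\<close>. After division
    by \<open>L\<close>, the term \<open>1 - L\<close> produces \<open>2|E| / d(v)\<close> and the
    \<open>-1\<close> of the formula.\<close>
  moreover have "(\<Sum>u\<in>nbhd n E v. D u) / real (deg n E v) = 1 - L"
    using D_step[OF v] Dv by (simp add: f_def)
  ultimately have X: "(1 / real (deg n E v)) * (\<Sum>u\<in>nbhd n E v. \<Sum>i. f i u - f i w) = D w - (1 - L)"
    by simp
  have mL: "m / real (deg n E v) = 1 / L" by (simp add: L_def)
  have "hitting_time n E w v = m / real (deg n E v) - 1
      + m / real (deg n E v) * ((1 / real (deg n E v)) * (\<Sum>u\<in>nbhd n E v. \<Sum>i. f i u - f i w))"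
    unfolding H X mL using L0 by (simp add: field_simps)
  then show ?thesis by (simp add: m_def f_def mult.assoc)
qed

section \<open>Truncation of the series and geometric decay of the walk\<close>

lemma suminf_tail_bound:
  fixes f :: "nat \<Rightarrow> real"
  assumes "0 \<le> \<rho>" "\<rho> < 1" "\<And>i. \<bar>f i\<bar> \<le> K * \<rho> ^ i"
  shows "\<bar>(\<Sum>i. f i) - (\<Sum>i<m. f i)\<bar> \<le> K * \<rho> ^ m / (1 - \<rho>)"
proof -
  have g: "(\<lambda>i. K * \<rho> ^ i) sums (K * (1 / (1 - \<rho>)))"
    using assms by (intro sums_mult geometric_sums) auto
  have f: "summable f"
    by (rule summable_comparison_test'[OF sums_summable[OF g], of 0]) (use assms in auto)
  have "(\<Sum>i. f i) - (\<Sum>i<m. f i) = (\<Sum>i. f (i + m))"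
    using suminf_minus_initial_segment[OF f, of m] by simp
  also have "\<bar>\<dots>\<bar> \<le> (\<Sum>i. K * \<rho> ^ (i + m))"
    using norm_suminf_le[of "\<lambda>i. f (i + m)" "\<lambda>i. K * \<rho> ^ (i + m)"] assms(3)
      summable_ignore_initial_segment[OF sums_summable[OF g], of m] by simp
  also have "\<dots> = K * \<rho> ^ m / (1 - \<rho>)"
  proof -
    have "(\<lambda>i. \<rho> ^ m * (K * \<rho> ^ i)) sums (\<rho> ^ m * (K * (1 / (1 - \<rho>))))"
      by (rule sums_mult[OF g])
    then show ?thesis by (simp add: sums_iff power_add mult_ac)
  qed
  finally show ?thesis .
qed

text \<open>Each neighbour of \<open>v\<close> contributes the same geometric tail bound; averaging
  over the neighbours keeps it, and only the factor \<open>2|E| / d(v)\<close> remains in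
  front.\<close>

lemma hitting_time_truncated:
  assumes graph: "is_graph n E" and pos: "\<And>u. u < n \<Longrightarrow> deg n E u > 0"
    and v: "v < n" and w: "w < n" "w \<noteq> v"
    and \<rho>: "0 \<le> \<rho>" "\<rho> < 1"
    and decay: "\<And>i u x. u < n \<Longrightarrow> x < n \<Longrightarrow> \<bar>rw_prob n E i u v - rw_prob n E i x v\<bar> \<le> K * \<rho> ^ i"
  shows "\<bar>hitting_time n E w v - (2 * real (num_edges n E) / real (deg n E v) - 1
    + 2 * real (num_edges n E) / real (deg n E v) * (1 / real (card (nbhd n E v)))
      * (\<Sum>u\<in>nbhd n E v. \<Sum>i=1..m. rw_prob n E i u v - rw_prob n E i w v))\<bar>
    \<le> 2 * real (num_edges n E) / real (deg n E v) * (K * \<rho> ^ Suc m / (1 - \<rho>))"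
proof -
  define M where "M = 2 * real (num_edges n E) / real (deg n E v)"
  define d where "d = real (deg n E v)"
  have d: "d > 0" using pos[OF v] by (simp add: d_def)
  let ?f = "\<lambda>u i. rw_prob n E i u v - rw_prob n E i w v"
  have tail: "\<bar>(\<Sum>i. ?f u i) - (\<Sum>i=1..m. ?f u i)\<bar> \<le> K * \<rho> ^ Suc m / (1 - \<rho>)"
    if "u \<in> nbhd n E v" for u
  proof -
    have u: "u < n" "u \<noteq> v" using that graph v by (auto simp: nbhd_def is_graph_def)
    \<comment> \<open>The term at time 0 vanishes because neither \<open>u\<close> nor
      \<open>w\<close> is \<open>v\<close>. So the sum from 1 to \<open>m\<close> accounts for the
      first \<open>Suc m\<close> terms, and the tail starts at exponent
      \<open>Suc m\<close>.\<close>
    have "(\<Sum>i<Suc m. ?f u i) = (\<Sum>i=1..m. ?f u i)"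
      unfolding sum.lessThan_Suc_shift using u w by (simp add: sum.atLeast1_atMost_eq)
    then show ?thesis using suminf_tail_bound[OF \<rho>, of "?f u" K "Suc m"] decay u w by simp
  qed
  have "\<bar>(\<Sum>u\<in>nbhd n E v. \<Sum>i. ?f u i) - (\<Sum>u\<in>nbhd n E v. \<Sum>i=1..m. ?f u i)\<bar>
      \<le> (\<Sum>u\<in>nbhd n E v. \<bar>(\<Sum>i. ?f u i) - (\<Sum>i=1..m. ?f u i)\<bar>)"
    unfolding sum_subtractf[symmetric] by (rule sum_abs)
  also have "\<dots> \<le> (\<Sum>u\<in>nbhd n E v. K * \<rho> ^ Suc m / (1 - \<rho>))"
    by (rule sum_mono) (rule tail)
  also have "\<dots> = d * (K * \<rho> ^ Suc m / (1 - \<rho>))" by (simp add: d_def deg_def)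
  finally have "(M / d) * \<bar>(\<Sum>u\<in>nbhd n E v. \<Sum>i. ?f u i) - (\<Sum>u\<in>nbhd n E v. \<Sum>i=1..m. ?f u i)\<bar>
      \<le> (M / d) * (d * (K * \<rho> ^ Suc m / (1 - \<rho>)))"
    by (rule mult_left_mono) (simp add: M_def d_def)
  then have "\<bar>(M / d) * ((\<Sum>u\<in>nbhd n E v. \<Sum>i. ?f u i) - (\<Sum>u\<in>nbhd n E v. \<Sum>i=1..m. ?f u i))\<bar>
      \<le> M * (K * \<rho> ^ Suc m / (1 - \<rho>))"
    using d by (simp add: abs_mult M_def d_def)
  moreover have "hitting_time n E w v = M - 1 + M * (1 / d) * (\<Sum>u\<in>nbhd n E v. \<Sum>i. ?f u i)"
    unfolding M_def d_def by (rule hitting_time_series[OF assms])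
  ultimately show ?thesis
    unfolding M_def[symmetric] by (simp add: d_def deg_def right_diff_distrib)
qed

text \<open>The deviation of \<open>f\<close> is measured after subtracting the constant that makes it orthogonal to
  \<open>\<phi>\<close>. One walk step fixes constants and contracts what is orthogonal to \<open>\<phi>\<close>;
  re-centring afterwards costs only a constant factor.\<close>
lemma rw_prob_decay:
  assumes graph: "is_graph n E"
    and contract: "\<And>g. ip n g \<phi> = 0 \<Longrightarrow>
      ip n (mat_app n (adj E) g) (mat_app n (adj E) g) \<le> \<mu>\<^sup>2 * ip n g g"
    and unit: "ip n \<phi> \<phi> = 1"
    and mass: "sqrt n / 2 \<le> (\<Sum>x<n. \<phi> x)"
    and \<delta>: "0 < \<delta>" "\<And>u. u < n \<Longrightarrow> \<delta> \<le> real (deg n E u)"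
    and \<rho>: "0 \<le> \<rho>" "10 * \<mu>\<^sup>2 \<le> \<rho>\<^sup>2 * \<delta>\<^sup>2"
    and v: "v < n" and "u < n" "x < n"
  shows "\<bar>rw_prob n E i u v - rw_prob n E i x v\<bar> \<le> 5 * \<rho> ^ i"
proof -
  define \<sigma> where "\<sigma> = (\<Sum>x<n. \<phi> x)"
  have n: "0 < n" using v by simp
  have \<sigma>: "0 < \<sigma>" "real n \<le> 4 * \<sigma>\<^sup>2"
  proof -
    show "0 < \<sigma>" using mass n less_le_trans[of 0 "sqrt n / 2"] by (simp add: \<sigma>_def)
    have "(sqrt n / 2)\<^sup>2 \<le> \<sigma>\<^sup>2" using mass by (intro power_mono) (auto simp: \<sigma>_def)
    then show "real n \<le> 4 * \<sigma>\<^sup>2" by (simp add: power_divide)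
  qed
  define c where "c g = ip n g \<phi> / \<sigma>" for g
  define dev where "dev g x = g x - c g" for g x
  define S where "S g = ip n (dev g) (dev g)" for g
  have one: "ip n (\<lambda>x. a) \<phi> = a * \<sigma>" for a
    by (simp add: ip_def \<sigma>_def sum_distrib_left)
  have dev_orth: "ip n (dev g) \<phi> = 0" for g
    unfolding dev_def using \<sigma> by (simp add: ip_diff one c_def)
  have dev_shift: "dev (\<lambda>x. g x - a) = dev g" for g a
    using \<sigma> by (simp add: dev_def c_def ip_diff one fun_eq_iff diff_divide_distrib)
  \<comment> \<open>The constant is 2 + 2 * 4: a square of a difference costs a factor 2 on each
    part, and Cauchy-Schwarz with \<open>n \<le> 4 * \<sigma>^2\<close> bounds the centring
    constant.\<close>
  have S_le: "S g \<le> 10 * ip n g g" for g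
  proof -
    have "(c g)\<^sup>2 * \<sigma>\<^sup>2 \<le> ip n g g"
      using ip_Cauchy_Schwarz[of n g \<phi>] \<sigma> unit by (simp add: c_def power_divide)
    moreover have "(c g)\<^sup>2 * real n \<le> (c g)\<^sup>2 * (4 * \<sigma>\<^sup>2)"
      by (intro mult_left_mono \<sigma>) simp
    ultimately have cn: "real n * (c g)\<^sup>2 \<le> 4 * ip n g g" by (simp add: mult_ac)
    have "S g \<le> (\<Sum>x<n. 2 * (g x * g x) + 2 * (c g)\<^sup>2)"
      unfolding S_def ip_def
    proof (rule sum_mono)
      fix x show "dev g x * dev g x \<le> 2 * (g x * g x) + 2 * (c g)\<^sup>2"
        using zero_le_square[of "g x + c g"] by (simp add: dev_def power2_eq_square algebra_simps)
    qed
    also have "\<dots> = 2 * ip n g g + 2 * (real n * (c g)\<^sup>2)"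
      by (simp add: ip_def sum.distrib sum_distrib_left)
    finally show ?thesis using cn by simp
  qed
  define f where "f i u = rw_prob n E i u v" for i u
  have "S (f i) \<le> 10 * (\<rho>\<^sup>2) ^ i" for i
  proof (induction i)
    case 0
    have "ip n (f 0) (f 0) = (\<Sum>u<n. if u = v then 1 else 0)"
      unfolding ip_def f_def by (intro sum.cong) auto
    also have "\<dots> = 1" using v by simp
    finally show ?case using S_le[of "f 0"] by simp
  next
    case (Suc i)
    \<comment> \<open>\<open>?r\<close> keeps the old centring constant: since the walk fixes
      constants, it is one walk step applied to \<open>dev (f i)\<close>. By
      \<open>dev_shift\<close>, re-centring \<open>?r\<close> gives the same deviation as
      re-centring \<open>f (Suc i)\<close>.\<close>
    let ?r = "\<lambda>u. f (Suc i) u - c (f i)" and ?Ag = "mat_app n (adj E) (dev (f i))"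
    have r: "?r u = ?Ag u / real (deg n E u)" if "u < n" for u
    proof -
      have "mat_app n (adj E) (\<lambda>x. c (f i)) u = c (f i) * real (deg n E u)"
        using mat_app_scale[of n "adj E" "c (f i)" "\<lambda>x. 1" u] by (simp add: mat_app_adj_one)
      then have "?Ag u = mat_app n (adj E) (f i) u - c (f i) * real (deg n E u)"
        unfolding dev_def mat_app_diff by simp
      moreover have "f (Suc i) u = mat_app n (adj E) (f i) u / real (deg n E u)"
        by (simp add: f_def sum_nbhd[symmetric])
      ultimately show ?thesis using \<delta>(1) \<delta>(2)[OF that] by (simp add: field_simps)
    qed
    have "\<delta>\<^sup>2 * ip n ?r ?r \<le> ip n ?Ag ?Ag"
      unfolding ip_def sum_distrib_left
    proof (rule sum_mono)
      fix u assume "u \<in> {..<n}"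
      then have u: "u < n" by simp
      have "\<delta>\<^sup>2 * (?r u)\<^sup>2 \<le> (real (deg n E u))\<^sup>2 * (?r u)\<^sup>2"
        using \<delta>(1) \<delta>(2)[OF u] by (intro mult_right_mono power_mono) auto
      also have "\<dots> = (?Ag u)\<^sup>2"
        using r[OF u] \<delta>(1) \<delta>(2)[OF u] by (simp add: power_divide)
      finally show "\<delta>\<^sup>2 * (?r u * ?r u) \<le> ?Ag u * ?Ag u" by (simp add: power2_eq_square)
    qed
    also have "\<dots> \<le> \<mu>\<^sup>2 * S (f i)" unfolding S_def by (rule contract) (rule dev_orth)
    \<comment> \<open>The factor 10 to be paid for re-centring is absorbed by the assumption on
      \<open>\<rho>\<close>, so \<open>S\<close> shrinks by \<open>\<rho>^2\<close> per step without
      further loss.\<close>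
    finally have "\<delta>\<^sup>2 * (10 * ip n ?r ?r) \<le> (10 * \<mu>\<^sup>2) * S (f i)" by simp
    also have "\<dots> \<le> (\<rho>\<^sup>2 * \<delta>\<^sup>2) * S (f i)"
      by (intro mult_right_mono \<rho>) (simp add: S_def ip_nonneg)
    finally have "10 * ip n ?r ?r \<le> \<rho>\<^sup>2 * S (f i)"
      using \<delta>(1) by (simp add: mult_ac)
    also have "\<dots> \<le> \<rho>\<^sup>2 * (10 * (\<rho>\<^sup>2) ^ i)" by (intro mult_left_mono Suc.IH) simp
    finally have "10 * ip n ?r ?r \<le> 10 * (\<rho>\<^sup>2) ^ Suc i" by simp
    moreover have "S (f (Suc i)) \<le> 10 * ip n ?r ?r"
      using S_le[of ?r] by (simp add: S_def dev_shift)
    ultimately show ?case by linarith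
  qed
  then have Si: "S (f i) \<le> 10 * (\<rho> ^ i)\<^sup>2" by (simp add: power_mult[symmetric] mult.commute)
  show ?thesis
  proof (cases "u = x")
    case True
    then show ?thesis using \<rho> by simp
  next
    case False
    \<comment> \<open>For distinct vertices both squared deviations are separate terms of
      \<open>S (f i)\<close>. This gives at most 20 times the square of \<open>\<rho> ^ i\<close>,
      and 5 is the rounded root.\<close>
    have "(f i u - f i x)\<^sup>2 \<le> 2 * ((dev (f i) u)\<^sup>2 + (dev (f i) x)\<^sup>2)"
      using zero_le_square[of "dev (f i) u + dev (f i) x"]
      by (simp add: dev_def power2_eq_square algebra_simps)
    also have "(dev (f i) u)\<^sup>2 + (dev (f i) x)\<^sup>2 = (\<Sum>y\<in>{u, x}. (dev (f i) y)\<^sup>2)"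
      using False by simp
    also have "\<dots> \<le> S (f i)" unfolding S_def ip_def power2_eq_square
      by (rule sum_mono2) (use \<open>u < n\<close> \<open>x < n\<close> in auto)
    finally have "(f i u - f i x)\<^sup>2 \<le> 2 * S (f i)" by simp
    moreover have "(5 * \<rho> ^ i)\<^sup>2 = 25 * (\<rho> ^ i)\<^sup>2" by (simp add: power_mult_distrib)
    moreover have "0 \<le> (\<rho> ^ i)\<^sup>2" by simp
    ultimately have "(f i u - f i x)\<^sup>2 \<le> (5 * \<rho> ^ i)\<^sup>2" using Si by linarith
    then have "\<bar>f i u - f i x\<bar> \<le> \<bar>5 * \<rho> ^ i\<bar>" by (simp only: abs_le_square_iff)
    then show ?thesis using \<rho>(1) by (simp add: f_def)
  qed
qed

section \<open>Quantitative estimates for graphs in the class\<close>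

text \<open>The list is decreasing, so every eigenvalue after the first lies between the second and
  the last, and bounding these two bounds them all.\<close>

lemma adj_eigs_contract:
  assumes graph: "is_graph n E" and n: "2 \<le> n"
    and \<phi>: "\<phi> \<in> carrier_vec n" "adj_mat n E *\<^sub>v \<phi> = adj_eigs n E ! 0 \<cdot>\<^sub>v \<phi>" "(\<Sum>i<n. (\<phi> $ i)\<^sup>2) = 1"
    and \<mu>: "max \<bar>adj_eigs n E ! 1\<bar> \<bar>adj_eigs n E ! (n - 1)\<bar> \<le> \<mu>" "\<mu> < \<bar>adj_eigs n E ! 0\<bar>"
    and "ip n g (\<lambda>i. \<phi> $ i) = 0"
  shows "ip n (mat_app n (adj E) g) (mat_app n (adj E) g) \<le> \<mu>\<^sup>2 * ip n g g"
proof (rule symmetric_norm_bound)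
  have A: "mat n n (\<lambda>(i, j). adj E i j) = adj_mat n E"
    by (simp add: adj_mat_def adj_def)
  show "char_poly (mat n n (\<lambda>(i, j). adj E i j)) = (\<Prod>l\<leftarrow>adj_eigs n E. [:- l, 1:])"
    unfolding A by (rule adj_eigs(3)[OF graph])
  show "\<bar>adj_eigs n E ! i\<bar> \<le> \<mu>" if "0 < i" "i < n" for i
  proof -
    have anti: "adj_eigs n E ! b \<le> adj_eigs n E ! a" if "a \<le> b" "b < n" for a b
      using adj_eigs(1,2)[OF graph] that
      by (cases "a = b") (auto simp: sorted_wrt_iff_nth_less)
    have "adj_eigs n E ! i \<le> adj_eigs n E ! 1" using that by (intro anti) auto
    moreover have "adj_eigs n E ! (n - 1) \<le> adj_eigs n E ! i" using that by (intro anti) auto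
    ultimately show ?thesis using \<mu>(1) by linarith
  qed
  show "mat_app n (adj E) (\<lambda>i. \<phi> $ i) x = adj_eigs n E ! 0 * \<phi> $ x" if "x < n" for x
  proof -
    have "(adj_mat n E *\<^sub>v \<phi>) $ x = (adj_eigs n E ! 0 \<cdot>\<^sub>v \<phi>) $ x" by (simp add: \<phi>(2))
    then show ?thesis using that \<phi>(1)
      by (simp add: A[symmetric] mat_app_def scalar_prod_def lessThan_atLeast0)
  qed
  show "ip n (\<lambda>i. \<phi> $ i) (\<lambda>i. \<phi> $ i) \<noteq> 0" using \<phi>(3) by (simp add: ip_def power2_eq_square)
qed (use adj_symmetric[OF graph] assms in auto)

text \<open>A non-asymptotic form of the result: \<open>big\<close> states how large
  \<open>n\<close> must be for all error terms to be dominated, so the final constant depends only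
  on \<open>c\<close> and \<open>k\<close>.\<close>

lemma hitting_time_bound_in_class:
  fixes p C c e :: real
  assumes cls: "in_class k C e n p E"
    and c: "1 \<le> c" "C \<le> c" and k: "0 < k" and n: "2 \<le> n" and ln1: "1 \<le> ln n"
    and big: "196 * c\<^sup>2 * (real k)\<^sup>2 \<le> n powr (1 / real k)"
    and p: "n powr (1 / real k) * ln n \<le> p * n" and e: "e \<le> 1 / 2"
    and v: "v < n" and w: "w < n" "w \<noteq> v"
  shows "\<bar>hitting_time n E w v - (2 * real (num_edges n E) / real (deg n E v) - 1
    + 2 * real (num_edges n E) / real (deg n E v) * (1 / real (card (nbhd n E v)))
      * (\<Sum>u\<in>nbhd n E v. \<Sum>i=1..3*k+1. rw_prob n E i u v - rw_prob n E i w v))\<bar>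
    \<le> 40 * (7 * c) ^ (3 * k + 2) * sqrt (ln n) / sqrt (p * n)"
proof -
  define x y where "x = p * n" and "y = n powr (1 / real k)"
  have k1: "1 \<le> (real k)\<^sup>2" using k by simp
  have c1: "1 \<le> c\<^sup>2" using c by simp
  have c2: "c\<^sup>2 \<le> c\<^sup>2 * (real k)\<^sup>2" using mult_left_mono[OF k1, of "c\<^sup>2"] by simp
  have y: "196 * c\<^sup>2 * (real k)\<^sup>2 \<le> y" using big by (simp add: y_def)
  have y1: "196 * c\<^sup>2 \<le> y" "1 \<le> y" using y c2 c1 by linarith+
  have xy: "y * ln n \<le> x" using p by (simp add: x_def y_def)
  have "y * 1 \<le> y * ln n" using ln1 y1 by (intro mult_left_mono) auto
  then have yx: "y \<le> x" using xy by simp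
  have x196: "196 * c\<^sup>2 * ln n \<le> x"
    using mult_right_mono[OF y1(1), of "ln n"] ln1 xy by linarith
  have x0: "x > 0" "1 \<le> x" using yx y1 by linarith+
  have p0: "p > 0" using x0 n by (simp add: x_def zero_less_mult_iff)
  define s where "s = sqrt x"
  have s2: "s\<^sup>2 = x" using x0 by (simp add: s_def)
  have s: "s > 0" "1 \<le> s" "14 * c \<le> s"
  proof -
    show "s > 0" "1 \<le> s" using x0 by (simp_all add: s_def)
    have "(14 * c)\<^sup>2 \<le> x" using yx y1 by (simp add: power_mult_distrib)
    then show "14 * c \<le> s" unfolding s_def by (rule real_le_rsqrt)
  qed
  have graph: "is_graph n E"
    and degs: "\<And>u. u < n \<Longrightarrow> \<bar>real (deg n E u) - p * n\<bar> \<le> C * sqrt (p * n * ln n)"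
    and edges: "\<bar>2 * real (num_edges n E) - p * (real n)^2\<bar> \<le> C * sqrt (p * (real n)^2 * ln n)"
    using cls unfolding in_class_def by blast+
  obtain \<phi> where \<phi>: "\<phi> \<in> carrier_vec n" "adj_mat n E *\<^sub>v \<phi> = adj_eigs n E ! 0 \<cdot>\<^sub>v \<phi>"
      "(\<Sum>i<n. (\<phi> $ i)\<^sup>2) = 1"
    and near: "\<And>i. i < n \<Longrightarrow> \<bar>\<phi> $ i - 1 / sqrt n\<bar> \<le> C * ln n powr (3/2) / (sqrt p * n * ln (p * n))"
    and top: "\<bar>adj_eigs n E ! 0 - p * n\<bar> \<le> e * (p * n)"
    and second: "max \<bar>adj_eigs n E ! 1\<bar> \<bar>adj_eigs n E ! (n - 1)\<bar> \<le> C * sqrt (p * n)"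
    using cls unfolding in_class_def Let_def by blast
  \<comment> \<open>The allowed deviation is at most \<open>x / 2\<close>, because \<open>x\<close>
    exceeds \<open>4 * c^2 * ln n\<close>.\<close>
  have deg: "x / 2 \<le> real (deg n E u)" if "u < n" for u
  proof -
    have "C * sqrt (x * ln n) \<le> c * sqrt (x * ln n)"
      using c x0 ln1 by (intro mult_right_mono) auto
    also have "\<dots> = sqrt (x * (c\<^sup>2 * ln n))"
      using c by (simp add: real_sqrt_mult)
    also have "\<dots> \<le> sqrt (x * (x / 4))"
      using x196 x0 c1 ln1 by (intro real_sqrt_le_mono mult_left_mono) auto
    also have "\<dots> = x / 2" using x0 by (simp add: real_sqrt_mult real_sqrt_divide)
    finally show ?thesis using degs[OF that] by (simp add: x_def abs_le_iff)
  qed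
  have E: "2 * real (num_edges n E) \<le> 2 * (x * n)"
  proof -
    have "C * sqrt (p * (real n)^2 * ln n) \<le> c * sqrt (x * n * ln n)"
      using c x0 p0 ln1 by (intro mult_mono) (auto simp: x_def power2_eq_square)
    also have "\<dots> = sqrt (x * n * (c\<^sup>2 * ln n))"
      using c by (simp add: real_sqrt_mult)
    also have "\<dots> \<le> sqrt (x * n * (x * n))"
    proof (intro real_sqrt_le_mono mult_left_mono)
      have "x * 1 \<le> x * n" using n x0 by (intro mult_left_mono) auto
      moreover have "0 \<le> c\<^sup>2 * ln n" using c1 ln1 by simp
      ultimately show "c\<^sup>2 * ln n \<le> x * n" using x196 by linarith
    qed (use x0 in auto)
    also have "\<dots> = x * n" using x0 by simp
    finally show ?thesis using edges by (simp add: x_def abs_le_iff power2_eq_square mult.assoc)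
  qed
  have M: "2 * real (num_edges n E) / real (deg n E v) \<le> 4 * n"
  proof -
    have "2 * real (num_edges n E) / real (deg n E v) \<le> 2 * (x * n) / (x / 2)"
      using E deg[OF v] x0 by (intro frac_le) auto
    then show ?thesis using x0 by (simp add: field_simps)
  qed
  \<comment> \<open>Every entry of \<open>\<phi>\<close> is at least half of
    \<open>1 / sqrt n\<close>. The error bound is controlled by \<open>ln x \<ge> l / k\<close> and
    \<open>sqrt x \<ge> 2 * c * k * sqrt l\<close>; the factor \<open>k^2\<close> in
    \<open>big\<close> serves the second inequality.\<close>
  have mass: "sqrt n / 2 \<le> (\<Sum>i<n. \<phi> $ i)"
  proof -
    define l where "l = ln n"
    have l: "1 \<le> l" using ln1 by (simp add: l_def)
    have lnx: "l / k \<le> ln x"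
    proof -
      have "ln y = l / k" using n by (simp add: y_def l_def ln_powr)
      moreover have "ln y \<le> ln x" using yx y1 x0 by (subst ln_le_cancel_iff) auto
      ultimately show ?thesis by simp
    qed
    have lx0: "0 < l / k" using l k by simp
    have sy: "2 * c * k \<le> sqrt y"
    proof (rule real_le_rsqrt)
      have "(2 * c * real k)\<^sup>2 = 4 * (c\<^sup>2 * (real k)\<^sup>2)" by (simp add: power_mult_distrib)
      moreover have "0 \<le> c\<^sup>2 * (real k)\<^sup>2" by simp
      ultimately show "(2 * c * real k)\<^sup>2 \<le> y" using y by linarith
    qed
    have "2 * c * k * sqrt l \<le> sqrt y * sqrt l" using sy l by (intro mult_right_mono) auto
    also have "\<dots> \<le> sqrt x" using xy by (simp add: l_def flip: real_sqrt_mult)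
    finally have sx: "2 * c * k * sqrt l \<le> sqrt x" .
    have pw: "l powr (3/2) = l * sqrt l"
      using powr_add[of l 1 "1/2"] l by (simp add: powr_half_sqrt)
    have den: "sqrt p * n * ln x = sqrt x * ln x * sqrt n"
      using p0 by (simp add: x_def real_sqrt_mult)
    have "2 * c * (l * sqrt l) = (2 * c * k * sqrt l) * (l / k)" using k by simp
    also have "\<dots> \<le> sqrt x * ln x" using sx lnx lx0 x0 by (intro mult_mono) auto
    finally have num: "2 * c * (l * sqrt l) \<le> sqrt x * ln x" .
    have "0 < ln x" using lnx lx0 by linarith
    then have den0: "0 < sqrt x * ln x" using x0 by (intro mult_pos_pos) auto
    have sn: "0 < sqrt n" using n by simp
    have "C * l powr (3/2) / (sqrt p * n * ln x) \<le> c * (l * sqrt l) / (sqrt x * ln x * sqrt n)"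
      unfolding pw den using c l mult_pos_pos[OF den0 sn]
      by (intro divide_right_mono mult_right_mono) auto
    also have "\<dots> \<le> (1 / 2) / sqrt n"
      using num den0 sn by (simp add: field_simps)
    finally have err: "C * l powr (3/2) / (sqrt p * n * ln x) \<le> 1 / (2 * sqrt n)" by simp
    have "1 / (2 * sqrt n) \<le> \<phi> $ i" if "i < n" for i
      using near[OF that] err by (simp add: x_def l_def abs_le_iff)
    then have "(\<Sum>i<n. 1 / (2 * sqrt n)) \<le> (\<Sum>i<n. \<phi> $ i)" by (intro sum_mono) auto
    moreover have "(\<Sum>i<n. 1 / (2 * sqrt n)) = sqrt n / 2"
      using sn by (simp add: field_simps)
    ultimately show ?thesis by simp
  qed
  define \<mu> where "\<mu> = c * s"
  have \<mu>1: "max \<bar>adj_eigs n E ! 1\<bar> \<bar>adj_eigs n E ! (n - 1)\<bar> \<le> \<mu>"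
  proof (rule order_trans[OF second])
    show "C * sqrt (p * n) \<le> \<mu>"
      unfolding \<mu>_def s_def x_def using c(2) s(1) by (intro mult_right_mono) (auto simp: s_def x_def)
  qed
  \<comment> \<open>The top eigenvalue is at least \<open>x / 2\<close>, which is at least
    \<open>7 * c * s\<close> since \<open>s \<ge> 14 * c\<close>.\<close>
  have \<mu>2: "\<mu> < \<bar>adj_eigs n E ! 0\<bar>"
  proof -
    have "e * x \<le> 1 / 2 * x" using e x0 by (intro mult_right_mono) auto
    then have "x / 2 \<le> adj_eigs n E ! 0" using top by (simp add: x_def abs_le_iff)
    moreover have "14 * c * s \<le> s * s" using s by (intro mult_right_mono) auto
    moreover have "0 < \<mu>" using c s by (simp add: \<mu>_def)
    ultimately show ?thesis using s2 by (simp add: \<mu>_def power2_eq_square)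
  qed
  \<comment> \<open>The factor 7 makes \<open>\<rho> * x / 2\<close> equal to
    \<open>7 / 2 * \<mu>\<close>, whose square exceeds \<open>10 * \<mu>^2\<close> as 49/4 > 10. The
    bound \<open>s \<ge> 14 * c\<close>, coming from 196 = 14^2 in \<open>big\<close>, gives
    \<open>\<rho> \<le> 1 / 2\<close>.\<close>
  define \<rho> where "\<rho> = 7 * c / s"
  have \<rho>: "0 \<le> \<rho>" "\<rho> \<le> 1 / 2" using c s by (simp_all add: \<rho>_def field_simps)
  have \<rho>\<mu>: "10 * \<mu>\<^sup>2 \<le> \<rho>\<^sup>2 * (x / 2)\<^sup>2"
  proof -
    have "\<rho>\<^sup>2 * (x / 2)\<^sup>2 = (\<rho> * x / 2)\<^sup>2" by (simp add: power_mult_distrib power_divide)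
    also have "\<rho> * x / 2 = 7 / 2 * \<mu>"
      using s by (simp add: \<rho>_def \<mu>_def s2[symmetric] power2_eq_square)
    finally show ?thesis by (simp add: power_mult_distrib power_divide)
  qed
  have deg_pos: "deg n E u > 0" if "u < n" for u
    using deg[OF that] x0 by (cases "deg n E u = 0") auto
  have decay: "\<bar>rw_prob n E i u v - rw_prob n E i z v\<bar> \<le> 5 * \<rho> ^ i" if "u < n" "z < n" for i u z
  proof (rule rw_prob_decay[OF graph _ _ mass _ deg \<rho>(1) \<rho>\<mu> v that])
    show "ip n (mat_app n (adj E) g) (mat_app n (adj E) g) \<le> \<mu>\<^sup>2 * ip n g g"
      if "ip n g (\<lambda>i. \<phi> $ i) = 0" for g
      by (rule adj_eigs_contract[OF graph n \<phi> \<mu>1 \<mu>2 that])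
    show "ip n (\<lambda>i. \<phi> $ i) (\<lambda>i. \<phi> $ i) = 1" using \<phi>(3) by (simp add: ip_def power2_eq_square)
  qed (use x0 in auto)
  \<comment> \<open>This is where the lower bound on \<open>p\<close> beats the factor
    \<open>n\<close>: \<open>n = y ^ k \<le> x ^ k = s ^ (2 * k)\<close>, so
    \<open>3 * k + 2\<close> powers of \<open>s\<close> absorb \<open>n\<close> and leave at least
    one factor \<open>s\<close> to spare.\<close>
  have "n * s \<le> s ^ (3 * k + 2)"
  proof -
    have "real n = y ^ k"
      using k n by (simp add: y_def powr_realpow[symmetric] powr_powr)
    also have "\<dots> \<le> x ^ k" using yx y1 by (intro power_mono) auto
    also have "\<dots> = s ^ (2 * k)" by (simp add: s2[symmetric] power_mult)
    finally have "n * s \<le> s ^ (2 * k) * s" using s by (intro mult_right_mono) auto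
    also have "\<dots> = s ^ (2 * k + 1)" by simp
    also have "\<dots> \<le> s ^ (3 * k + 2)" using s by (intro power_increasing) auto
    finally show ?thesis .
  qed
  then have "n * ((7 * c) ^ (3 * k + 2) / s ^ (3 * k + 2)) \<le> (7 * c) ^ (3 * k + 2) / s"
    using s c mult_left_mono[of "n * s" "s ^ (3 * k + 2)" "(7 * c) ^ (3 * k + 2)"]
    by (simp add: field_simps del: power_Suc power_add)
  then have n\<rho>: "n * \<rho> ^ (3 * k + 2) \<le> (7 * c) ^ (3 * k + 2) / s"
    by (simp only: \<rho>_def power_divide)
  have "\<bar>hitting_time n E w v - (2 * real (num_edges n E) / real (deg n E v) - 1
    + 2 * real (num_edges n E) / real (deg n E v) * (1 / real (card (nbhd n E v)))
      * (\<Sum>u\<in>nbhd n E v. \<Sum>i=1..3*k+1. rw_prob n E i u v - rw_prob n E i w v))\<bar>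
    \<le> 2 * real (num_edges n E) / real (deg n E v) * (5 * \<rho> ^ Suc (3 * k + 1) / (1 - \<rho>))"
    by (rule hitting_time_truncated[OF graph deg_pos v w \<rho>(1) _ decay]) (use \<rho> in auto)
  \<comment> \<open>The constant 40 is 4 from the ratio of edges to degree, 5 from the decay bound
    and 2 from \<open>1 / (1 - \<rho>)\<close>.\<close>
  also have "\<dots> \<le> (4 * n) * (5 * \<rho> ^ (3 * k + 2) / (1 / 2))"
  proof (intro mult_mono M)
    show "5 * \<rho> ^ Suc (3 * k + 1) / (1 - \<rho>) \<le> 5 * \<rho> ^ (3 * k + 2) / (1 / 2)"
      using \<rho> by (intro frac_le) auto
  qed (use \<rho> in \<open>auto intro!: divide_nonneg_nonneg\<close>)
  also have "\<dots> = 40 * (n * \<rho> ^ (3 * k + 2))" by simp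
  also have "\<dots> \<le> 40 * ((7 * c) ^ (3 * k + 2) / s)" using n\<rho> by simp
  also have "\<dots> = 40 * (7 * c) ^ (3 * k + 2) * 1 / s" by simp
  also have "\<dots> \<le> 40 * (7 * c) ^ (3 * k + 2) * sqrt (ln n) / s"
    using s c ln1 by (intro divide_right_mono mult_left_mono) auto
  finally show ?thesis unfolding s_def x_def .
qed

theorem theorem6p2:
  fixes k :: nat and p :: "nat \<Rightarrow> real" and C :: real and eps :: "nat \<Rightarrow> real"
  assumes "k \<ge> 2"
    and "\<forall>\<^sub>F n in sequentially. ln n / n powr ((real k - 1) / real k) \<le> p n"
    and "\<exists>c>0. \<forall>\<^sub>F n in sequentially. p n \<le> 1 - c * (ln n)^4 / n"
    and "eps \<longlonglongrightarrow> 0"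
  shows "\<exists>D N. \<forall>n \<ge> N. \<forall>E. in_class k C (eps n) n (p n) E \<longrightarrow>
           (\<forall>v<n. \<forall>w<n. v \<noteq> w \<longrightarrow>
             \<bar>hitting_time n E w v -
               (2 * real (num_edges n E) / real (deg n E v) - 1
                + 2 * real (num_edges n E) / real (deg n E v)
                  * (1 / real (card (nbhd n E v)))
                  * (\<Sum>u\<in>nbhd n E v. \<Sum>i=1..3*k+1. rw_prob n E i u v - rw_prob n E i w v))\<bar>
             \<le> D * sqrt (ln n) / sqrt (p n * n))"
proof -
  \<comment> \<open>Replacing \<open>C\<close> by \<open>max 1 C\<close> makes the constant positive
    and at least 1, whatever the sign of \<open>C\<close>.\<close>
  define c where "c = max 1 C"
  define B where "B = 196 * c\<^sup>2 * (real k)\<^sup>2"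
  have large: "\<forall>\<^sub>F n in sequentially. a \<le> real n" for a
    using filterlim_real_sequentially by (simp add: filterlim_at_top)
  have "\<forall>\<^sub>F n in sequentially. eps n \<le> 1 / 2"
    using order_tendstoD(2)[OF \<open>eps \<longlonglongrightarrow> 0\<close>, of "1 / 2"] by (auto elim: eventually_mono)
  \<comment> \<open>The threshold \<open>exp 1\<close> yields \<open>ln n \<ge> 1\<close>, and
    \<open>B powr k \<le> n\<close> yields \<open>big\<close> after taking the \<open>k\<close>-th
    root. The resulting \<open>N\<close> is chosen before the graph, so it is uniform over the
    class.\<close>
  then have "\<forall>\<^sub>F n in sequentially. eps n \<le> 1 / 2 \<and> exp 1 \<le> real n \<and> B powr k \<le> real n \<and> 2 \<le> real n
      \<and> ln n / n powr ((real k - 1) / real k) \<le> p n"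
    by (intro eventually_conj large assms(2))
  then obtain N where N: "\<And>n. n \<ge> N \<Longrightarrow> eps n \<le> 1 / 2 \<and> exp 1 \<le> real n \<and> B powr k \<le> real n \<and> 2 \<le> real n
      \<and> ln n / n powr ((real k - 1) / real k) \<le> p n"
    unfolding eventually_sequentially by blast
  show ?thesis
  proof (intro exI[of _ "40 * (7 * c) ^ (3 * k + 2)"] exI[of _ N] allI impI)
    fix n E v w
    assume nN: "N \<le> n" and cls: "in_class k C (eps n) n (p n) E" and vw: "v < n" "w < n" "v \<noteq> w"
    have n: "2 \<le> n" and ln1: "1 \<le> ln (real n)"
      using N[OF nN] by (auto simp: ln_ge_iff)
    have "B = (B powr k) powr (1 / real k)"
      using \<open>k \<ge> 2\<close> by (simp add: powr_powr B_def)
    also have "\<dots> \<le> n powr (1 / real k)" using N[OF nN] by (intro powr_mono2) auto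
    finally have B: "B \<le> n powr (1 / real k)" .
    \<comment> \<open>The exponents \<open>1 / k\<close> and \<open>(k - 1) / k\<close> add up to 1,
      which turns the lower bound on \<open>p n\<close> into one on \<open>p n * n\<close>.\<close>
    have "n powr (1 / real k) * ln n = n * (ln n / n powr ((real k - 1) / real k))"
    proof -
      have "n powr (1 / real k) * n powr ((real k - 1) / real k) = n"
        using \<open>k \<ge> 2\<close> n by (simp add: powr_add[symmetric] add_divide_distrib[symmetric])
      then show ?thesis using n by (simp add: field_simps)
    qed
    also have "\<dots> \<le> n * p n" using N[OF nN] by (intro mult_left_mono) auto
    finally have p: "n powr (1 / real k) * ln n \<le> p n * n" by (simp add: mult.commute)
    show "\<bar>hitting_time n E w v -
               (2 * real (num_edges n E) / real (deg n E v) - 1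
                + 2 * real (num_edges n E) / real (deg n E v)
                  * (1 / real (card (nbhd n E v)))
                  * (\<Sum>u\<in>nbhd n E v. \<Sum>i=1..3*k+1. rw_prob n E i u v - rw_prob n E i w v))\<bar>
             \<le> 40 * (7 * c) ^ (3 * k + 2) * sqrt (ln n) / sqrt (p n * n)"
      by (rule hitting_time_bound_in_class[OF cls _ _ _ n ln1 B[unfolded B_def] p])
        (use \<open>k \<ge> 2\<close> N[OF nN] vw in \<open>auto simp: c_def\<close>)
  qed
qed

end
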